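(* (Intermediate value property for centre-valued traces.) Let $\mathfrak{J}$ be a JW$^*$-algebra of type $II_1$, and let $\tau:\mathfrak{J}\to Z(\mathfrak{J})$ denote its (unique) faithful normal unital centre-valued trace. Let $p\in\mathcal{P}(\mathfrak{J})$. Then for each $w\in Z(\mathfrak{J})$ with $0\le w\le\tau(p)$ there exists $q\in\mathcal{P}(\mathfrak{J})$ satisfying $q\le p$ and $\tau(q)=w$.
   Context: A JW$^*$-algebra is a weak$^*$-closed, self-adjoint complex Jordan subalgebra $\mathfrak{J}$ of a von Neumann algebra, with Jordan product $a\circ b=\frac12(ab+ba)$; it has a unit $\mathbf{1}$. Write $U_{a}(b)=2(a\circ b)\circ a-a^2\circ b$ $(=aba)$. $\mathcal{P}(\mathfrak{J})$ is the lattice of projections ($p^*=p=p\circ p$). The centre $Z(\mathfrak{J})$ consists of those $z$ with $(z\circ c)\circ b=z\circ(c\circ b)$ for all $b,c\in\mathfrak{J}$; the central cover $c(p)$ of a projection $p$ is the smallest central projection dominating $p$. A symmetry is $s=s^*$ with $s^2=\mathbf{1}$. A projection $p$ is abelian if the Jordan algebra $U_p(\mathfrak{J})$ is associative; it is modular if the lattice $[0,p]=\{q\in\mathcal{P}(\mathfrak{J}):q\le p\}$ is modular, i.e. $(e\vee q)\wedge r=e\vee(q\wedge r)$ for all $e,q,r\in[0,p]$ with $e\le r$. $\mathfrak{J}$ is modular if $\mathbf{1}$ is modular. $\mathfrak{J}$ is of type $II$ if it contains a modular projection with central cover $\mathbf{1}$ and contains no non-zero abelian projection; it is of type $II_1$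 if it is of type $II$ and modular. A centre-valued trace is an additive map $\tau:\mathfrak{J}\to Z(\mathfrak{J})$ with $\tau(z\circ x)=z\circ\tau(x)$ for $z\in Z(\mathfrak{J})$, $\tau(x)\ge0$ for $x\ge 0$, $\tau(U_s(x))=\tau(x)$ for every symmetry $s$, and $\tau(\mathbf{1})=\mathbf{1}$. It is faithful if $\tau(x)\neq 0$ for every non-zero $x\ge0$, and normal if $\tau(\sup x_j)=\sup\tau(x_j)$ for every bounded increasing net $(x_j)$ of positive elements. Every modular JW$^*$-algebra has a unique faithful normal centre-valued trace (Topping). *)

theory Defs
  imports "HOL-Algebra.Lattice" "HOL-Analysis.Analysis"
begin

section \<open>Complex Hilbert spaces and bounded operators\<close>

text \<open>
  The inner product is conjugate-linear in the first argument and linear in the second.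
  Positive definiteness is contained in the last axiom.
\<close>

class complex_hilbert = banach +
  fixes cscale :: "complex \<Rightarrow> 'a \<Rightarrow> 'a" (infixr "*\<^sub>C" 75)
    and cinner :: "'a \<Rightarrow> 'a \<Rightarrow> complex"
  assumes cscale_add_right: "c *\<^sub>C (x + y) = c *\<^sub>C x + c *\<^sub>C y"
    and cscale_add_left: "(c + d) *\<^sub>C x = c *\<^sub>C x + d *\<^sub>C x"
    and cscale_cscale: "c *\<^sub>C (d *\<^sub>C x) = (c * d) *\<^sub>C x"
    and cscale_of_real: "complex_of_real r *\<^sub>C x = r *\<^sub>R x"
    and cinner_commute: "cinner x y = cnj (cinner y x)"
    and cinner_add_right: "cinner x (y + z) = cinner x y + cinner x z"
    and cinner_cscale_right: "cinner x (c *\<^sub>C y) = c * cinner x y"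
    and cinner_self: "cinner x x = complex_of_real ((norm x)\<^sup>2)"
begin

lemma cinner_cscale_left: "cinner (c *\<^sub>C x) y = cnj c * cinner x y"
  by (metis cinner_commute cinner_cscale_right complex_cnj_mult)

lemma norm_cscale: "norm (c *\<^sub>C x) = cmod c * norm x"
proof -
  have "complex_of_real ((norm (c *\<^sub>C x))\<^sup>2) = (c * cnj c) * cinner x x"
    unfolding cinner_self[symmetric] by (simp add: cinner_cscale_left cinner_cscale_right)
  also have "\<dots> = complex_of_real ((cmod c * norm x)\<^sup>2)"
    by (simp add: cinner_self complex_norm_square[symmetric] power_mult_distrib)
  finally have "(norm (c *\<^sub>C x))\<^sup>2 = (cmod c * norm x)\<^sup>2"
    by (simp only: of_real_eq_iff)
  then show ?thesis
    by (simp add: power2_eq_iff_nonneg)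
qed

lemma cscale_scaleR: "c *\<^sub>C (r *\<^sub>R x) = r *\<^sub>R (c *\<^sub>C x)"
  by (metis cscale_cscale cscale_of_real mult.commute)

end

text \<open>
  The type \<^typ>\<open>'h \<Rightarrow>\<^sub>L 'h\<close> consists of the bounded real-linear maps; the bounded operators of
  the complex Hilbert space are the complex-linear ones among them.
\<close>

definition bounded_ops :: "('h::complex_hilbert \<Rightarrow>\<^sub>L 'h) set" where
  "bounded_ops = {T :: 'h \<Rightarrow>\<^sub>L 'h. \<forall>c x. T (c *\<^sub>C x) = c *\<^sub>C T x}"

lift_definition op_cscale :: "complex \<Rightarrow> ('h::complex_hilbert \<Rightarrow>\<^sub>L 'h) \<Rightarrow> ('h \<Rightarrow>\<^sub>L 'h)"
  is "\<lambda>c T x. c *\<^sub>C T x"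
proof -
  fix c and f :: "'h \<Rightarrow> 'h"
  assume f: "bounded_linear f"
  have "bounded_linear (\<lambda>y::'h. c *\<^sub>C y)"
    by (rule bounded_linear_intro[where K = "cmod c"])
      (simp_all add: cscale_add_right cscale_scaleR norm_cscale mult.commute)
  then show "bounded_linear (\<lambda>x. c *\<^sub>C f x)"
    by (rule bounded_linear_compose[OF _ f])
qed

definition is_adjoint :: "('h::complex_hilbert \<Rightarrow>\<^sub>L 'h) \<Rightarrow> ('h \<Rightarrow>\<^sub>L 'h) \<Rightarrow> bool" where
  "is_adjoint S T \<longleftrightarrow> (\<forall>x y. cinner (S x) y = cinner x (T y))"

definition adjoint_closed :: "('h::complex_hilbert \<Rightarrow>\<^sub>L 'h) set \<Rightarrow> bool" where
  "adjoint_closed A \<longleftrightarrow> (\<forall>T\<in>A. \<exists>S\<in>A. is_adjoint S T)"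

abbreviation self_adjoint :: "('h::complex_hilbert \<Rightarrow>\<^sub>L 'h) \<Rightarrow> bool" where
  "self_adjoint T \<equiv> is_adjoint T T"

definition op_nonneg :: "('h::complex_hilbert \<Rightarrow>\<^sub>L 'h) \<Rightarrow> bool" where
  "op_nonneg T \<longleftrightarrow> (\<forall>x. cinner x (T x) \<in> \<real>\<^sub>\<ge>\<^sub>0)"

definition op_le :: "('h::complex_hilbert \<Rightarrow>\<^sub>L 'h) \<Rightarrow> ('h \<Rightarrow>\<^sub>L 'h) \<Rightarrow> bool" (infix "\<preceq>" 50) where
  "S \<preceq> T \<longleftrightarrow> op_nonneg (T - S)"

definition op_order :: "('h::complex_hilbert \<Rightarrow>\<^sub>L 'h) set \<Rightarrow> ('h \<Rightarrow>\<^sub>L 'h) gorder" where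
  "op_order A = \<lparr>carrier = A, eq = (=), le = (\<preceq>)\<rparr>"


section \<open>The weak* topology and von Neumann algebras\<close>

text \<open>
  The predual of the bounded operators (the trace class) acts through the functionals
  \<open>T \<mapsto> (\<Sum>n. \<langle>x\<^sub>n, T y\<^sub>n\<rangle>)\<close> with square-summable sequences of vectors, so these
  functionals induce the weak* topology.  The weak* topology of a von Neumann algebra is the
  subspace topology.
\<close>

definition weak_star_topology :: "('h::complex_hilbert \<Rightarrow>\<^sub>L 'h) topology" where
  "weak_star_topology = topology_generated_by
     {{T \<in> bounded_ops :: ('h \<Rightarrow>\<^sub>L 'h) set. (\<Sum>n. cinner (x n) (T (y n))) \<in> U} | (x :: nat \<Rightarrow> 'h) (y :: nat \<Rightarrow> 'h) U.
        summable (\<lambda>n. (norm (x n))\<^sup>2) \<and> summable (\<lambda>n. (norm (y n))\<^sup>2) \<and> open U}"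

definition von_neumann_algebra :: "('h::complex_hilbert \<Rightarrow>\<^sub>L 'h) set \<Rightarrow> bool" where
  "von_neumann_algebra M \<longleftrightarrow>
     M \<subseteq> bounded_ops \<and> id_blinfun \<in> M \<and>
     (\<forall>a\<in>M. \<forall>b\<in>M. a + b \<in> M) \<and> (\<forall>c. \<forall>a\<in>M. op_cscale c a \<in> M) \<and>
     (\<forall>a\<in>M. \<forall>b\<in>M. a o\<^sub>L b \<in> M) \<and> adjoint_closed M \<and>
     closedin weak_star_topology M"


section \<open>JW*-algebras\<close>

definition jprod :: "('h::complex_hilbert \<Rightarrow>\<^sub>L 'h) \<Rightarrow> ('h \<Rightarrow>\<^sub>L 'h) \<Rightarrow> ('h \<Rightarrow>\<^sub>L 'h)" (infixl "\<bullet>\<^sub>J" 70) where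
  "a \<bullet>\<^sub>J b = (1 / 2) *\<^sub>R ((a o\<^sub>L b) + (b o\<^sub>L a))"

definition jw_star_algebra :: "('h::complex_hilbert \<Rightarrow>\<^sub>L 'h) set \<Rightarrow> bool" where
  "jw_star_algebra J \<longleftrightarrow>
     (\<exists>M. von_neumann_algebra M \<and> J \<subseteq> M \<and> closedin (subtopology weak_star_topology M) J) \<and>
     0 \<in> J \<and> (\<forall>a\<in>J. \<forall>b\<in>J. a + b \<in> J) \<and> (\<forall>c. \<forall>a\<in>J. op_cscale c a \<in> J) \<and>
     (\<forall>a\<in>J. \<forall>b\<in>J. a \<bullet>\<^sub>J b \<in> J) \<and> adjoint_closed J"

text \<open>
  The unit of a JW*-algebra always exists and is unique, but it may differ from the identity
  operator of the Hilbert space.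
\<close>

definition junit :: "('h::complex_hilbert \<Rightarrow>\<^sub>L 'h) set \<Rightarrow> ('h \<Rightarrow>\<^sub>L 'h)" where
  "junit J = (THE e. e \<in> J \<and> (\<forall>a\<in>J. e \<bullet>\<^sub>J a = a))"

definition U_op :: "('h::complex_hilbert \<Rightarrow>\<^sub>L 'h) \<Rightarrow> ('h \<Rightarrow>\<^sub>L 'h) \<Rightarrow> ('h \<Rightarrow>\<^sub>L 'h)" where
  "U_op a b = 2 *\<^sub>R ((a \<bullet>\<^sub>J b) \<bullet>\<^sub>J a) - (a \<bullet>\<^sub>J a) \<bullet>\<^sub>J b"

definition projections :: "('h::complex_hilbert \<Rightarrow>\<^sub>L 'h) set \<Rightarrow> ('h \<Rightarrow>\<^sub>L 'h) set" where
  "projections J = {p \<in> J. self_adjoint p \<and> p \<bullet>\<^sub>J p = p}"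

definition symmetries :: "('h::complex_hilbert \<Rightarrow>\<^sub>L 'h) set \<Rightarrow> ('h \<Rightarrow>\<^sub>L 'h) set" where
  "symmetries J = {s \<in> J. self_adjoint s \<and> s \<bullet>\<^sub>J s = junit J}"

definition jcentre :: "('h::complex_hilbert \<Rightarrow>\<^sub>L 'h) set \<Rightarrow> ('h \<Rightarrow>\<^sub>L 'h) set" where
  "jcentre J = {z \<in> J. \<forall>b\<in>J. \<forall>c\<in>J. (z \<bullet>\<^sub>J c) \<bullet>\<^sub>J b = z \<bullet>\<^sub>J (c \<bullet>\<^sub>J b)}"

definition central_cover :: "('h::complex_hilbert \<Rightarrow>\<^sub>L 'h) set \<Rightarrow> ('h \<Rightarrow>\<^sub>L 'h) \<Rightarrow> ('h \<Rightarrow>\<^sub>L 'h)" where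
  "central_cover J p =
     (let C = projections J \<inter> jcentre J in THE c. least (op_order C) c {c \<in> C. p \<preceq> c})"

definition abelian_projection :: "('h::complex_hilbert \<Rightarrow>\<^sub>L 'h) set \<Rightarrow> ('h \<Rightarrow>\<^sub>L 'h) \<Rightarrow> bool" where
  "abelian_projection J p \<longleftrightarrow> p \<in> projections J \<and>
     (\<forall>a\<in>U_op p ` J. \<forall>b\<in>U_op p ` J. \<forall>c\<in>U_op p ` J. (a \<bullet>\<^sub>J b) \<bullet>\<^sub>J c = a \<bullet>\<^sub>J (b \<bullet>\<^sub>J c))"

definition projection_interval ::
    "('h::complex_hilbert \<Rightarrow>\<^sub>L 'h) set \<Rightarrow> ('h \<Rightarrow>\<^sub>L 'h) \<Rightarrow> ('h \<Rightarrow>\<^sub>L 'h) gorder" where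
  "projection_interval J p = op_order {q \<in> projections J. q \<preceq> p}"

definition modular_projection :: "('h::complex_hilbert \<Rightarrow>\<^sub>L 'h) set \<Rightarrow> ('h \<Rightarrow>\<^sub>L 'h) \<Rightarrow> bool" where
  "modular_projection J p \<longleftrightarrow> p \<in> projections J \<and>
     (let L = projection_interval J p in
      \<forall>e\<in>carrier L. \<forall>q\<in>carrier L. \<forall>r\<in>carrier L. e \<sqsubseteq>\<^bsub>L\<^esub> r \<longrightarrow>
        (e \<squnion>\<^bsub>L\<^esub> q) \<sqinter>\<^bsub>L\<^esub> r = e \<squnion>\<^bsub>L\<^esub> (q \<sqinter>\<^bsub>L\<^esub> r))"

definition modular_algebra :: "('h::complex_hilbert \<Rightarrow>\<^sub>L 'h) set \<Rightarrow> bool" where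
  "modular_algebra J \<longleftrightarrow> modular_projection J (junit J)"

definition type_II :: "('h::complex_hilbert \<Rightarrow>\<^sub>L 'h) set \<Rightarrow> bool" where
  "type_II J \<longleftrightarrow>
     (\<exists>p. modular_projection J p \<and> central_cover J p = junit J) \<and>
     (\<forall>p. abelian_projection J p \<longrightarrow> p = 0)"

definition type_II1 :: "('h::complex_hilbert \<Rightarrow>\<^sub>L 'h) set \<Rightarrow> bool" where
  "type_II1 J \<longleftrightarrow> type_II J \<and> modular_algebra J"


section \<open>Centre-valued traces\<close>

text \<open>Only the restriction of \<open>\<tau>\<close> to \<open>J\<close> is relevant below.\<close>

definition centre_valued_trace ::
    "('h::complex_hilbert \<Rightarrow>\<^sub>L 'h) set \<Rightarrow> (('h \<Rightarrow>\<^sub>L 'h) \<Rightarrow> ('h \<Rightarrow>\<^sub>L 'h)) \<Rightarrow> bool" where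
  "centre_valued_trace J \<tau> \<longleftrightarrow>
     (\<forall>x\<in>J. \<tau> x \<in> jcentre J) \<and>
     (\<forall>x\<in>J. \<forall>y\<in>J. \<tau> (x + y) = \<tau> x + \<tau> y) \<and>
     (\<forall>z\<in>jcentre J. \<forall>x\<in>J. \<tau> (z \<bullet>\<^sub>J x) = z \<bullet>\<^sub>J \<tau> x) \<and>
     (\<forall>x\<in>J. 0 \<preceq> x \<longrightarrow> 0 \<preceq> \<tau> x) \<and>
     (\<forall>s\<in>symmetries J. \<forall>x\<in>J. \<tau> (U_op s x) = \<tau> x) \<and>
     \<tau> (junit J) = junit J"

definition faithful_trace ::
    "('h::complex_hilbert \<Rightarrow>\<^sub>L 'h) set \<Rightarrow> (('h \<Rightarrow>\<^sub>L 'h) \<Rightarrow> ('h \<Rightarrow>\<^sub>L 'h)) \<Rightarrow> bool" where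
  "faithful_trace J \<tau> \<longleftrightarrow> (\<forall>x\<in>J. 0 \<preceq> x \<and> x \<noteq> 0 \<longrightarrow> \<tau> x \<noteq> 0)"

text \<open>
  The supremum of an increasing net depends only on its range, which is a non-empty upward
  directed set; conversely such a set, indexed by itself, is an increasing net.
  The supremum is formed in \<open>J\<close>, that of the image in the centre.  A set that has a supremum is
  bounded above, and bounded increasing nets in a JW*-algebra do have suprema.
\<close>

definition normal_trace ::
    "('h::complex_hilbert \<Rightarrow>\<^sub>L 'h) set \<Rightarrow> (('h \<Rightarrow>\<^sub>L 'h) \<Rightarrow> ('h \<Rightarrow>\<^sub>L 'h)) \<Rightarrow> bool" where
  "normal_trace J \<tau> \<longleftrightarrow>
     (\<forall>D x. D \<subseteq> {a \<in> J. 0 \<preceq> a} \<and> D \<noteq> {} \<and> (\<forall>a\<in>D. \<forall>b\<in>D. \<exists>c\<in>D. a \<preceq> c \<and> b \<preceq> c) \<and>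
        least (op_order J) x (Upper (op_order J) D) \<longrightarrow>
        least (op_order (jcentre J)) (\<tau> x) (Upper (op_order (jcentre J)) (\<tau> ` D)))"

end

theory Submission
  imports Defs
begin

text \<open>
  By normality the projections \<open>q \<le> p\<close> with \<open>\<tau> q \<le> w\<close> are closed under suprema of chains, so there
  is a maximal one. If \<open>v = w - \<tau> q\<close> were not zero, then \<open>\<epsilon> z \<le> z v\<close> for some \<open>\<epsilon> > 0\<close> and some
  non-zero central projection \<open>z\<close>, and \<open>e = z (p - q)\<close> is not zero because
  \<open>\<tau> (p - q) \<ge> v\<close>. A non-zero projection \<open>r \<le> e\<close> with \<open>\<tau> r \<le> \<epsilon> z\<close> then contradicts the maximality
  of \<open>q\<close>. Such an \<open>r\<close> arises by repeated halving: as \<open>e\<close> is not abelian, it has a subprojection \<open>f\<close>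
  that is not of the form \<open>c e\<close> with \<open>c\<close> central, and choosing between \<open>f\<close> and \<open>e - f\<close> on complementary
  central summands gives a non-zero \<open>g \<le> e\<close> with \<open>2 \<tau> g \<le> \<tau> e\<close>.

  The spectral theory is done for the real inner product \<open>Re \<langle>x, y\<rangle>\<close> and for
  real Jordan algebras closed under strong limits of bounded sequences; no unit is needed.
\<close>

section \<open>Positive operators\<close>

text \<open>A Jordan algebra need not contain the operator product of two of its elements, but it
  does when they commute, since then \<open>a \<bullet>\<^sub>J b = a o\<^sub>L b\<close>. Every
  construction therefore works with commuting operators, and range projections, square roots and
  positive parts come with the statement that they commute with whatever commutes with the given
  operator.

  The values of the trace are only partially ordered, so the traces of \<open>f\<close> and
  \<open>e - f\<close> need not be comparable. A central projection makes them comparable on two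
  complementary summands. The choice c (e - f) + (1 - c) f vanishes exactly when f = c e. This is
  why subprojections cut out by the centre have to be excluded, and why a corner in which all
  projections are of that kind has to be recognised as associative. The partial order is also the
  reason for passing to a central summand before comparing \<open>v\<close> with a number.\<close>

definition rin :: "'h::complex_hilbert \<Rightarrow> 'h \<Rightarrow> real" where
  "rin x y = Re (cinner x y)"

lemma rin_self: "rin x x = (norm x)\<^sup>2"
  by (simp add: rin_def cinner_self)

lemma rin_commute: "rin x y = rin y x"
  by (metis rin_def cinner_commute cnj.simps(1))

lemma rin_add_right: "rin x (y + z) = rin x y + rin x z"
  by (simp add: rin_def cinner_add_right)

lemma rin_scaleR_right: "rin x (r *\<^sub>R y) = r * rin x y"
  by (simp add: rin_def cinner_cscale_right flip: cscale_of_real)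

lemma rin_le_norm: "rin x y \<le> norm x * norm y"
proof -
  have "(norm (x + y))\<^sup>2 = (norm x)\<^sup>2 + 2 * rin x y + (norm y)\<^sup>2"
    by (simp add: rin_add_right rin_commute[of "x + y"] rin_commute[of y x] flip: rin_self)
  moreover have "(norm (x + y))\<^sup>2 \<le> (norm x + norm y)\<^sup>2"
    by (simp add: norm_triangle_ineq power_mono)
  ultimately show ?thesis
    by (simp add: power2_sum)
qed

interpretation rin: bounded_bilinear "rin :: 'h::complex_hilbert \<Rightarrow> 'h \<Rightarrow> real"
proof
  fix a a' b b' :: 'h and r :: real
  show "rin a (b + b') = rin a b + rin a b'"
    by (rule rin_add_right)
  show "rin (a + a') b = rin a b + rin a' b"
    by (metis rin_commute rin_add_right)
  show "rin a (r *\<^sub>R b) = r *\<^sub>R rin a b"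
    by (simp add: rin_scaleR_right)
  show "rin (r *\<^sub>R a) b = r *\<^sub>R rin a b"
    by (metis rin_commute rin_scaleR_right real_scaleR_def)
  show "\<exists>K. \<forall>a b::'h. norm (rin a b) \<le> norm a * norm b * K"
  proof (intro exI allI)
    fix a b :: 'h
    have "- rin a b = rin a (- b)"
      using rin_scaleR_right[of a "-1" b] by simp
    then show "norm (rin a b) \<le> norm a * norm b * 1"
      using rin_le_norm[of a b] rin_le_norm[of a "- b"] by simp
  qed
qed

lemmas op_simps = blinfun.add_left blinfun.add_right blinfun.diff_left blinfun.diff_right
  blinfun.minus_left blinfun.minus_right blinfun.scaleR_left blinfun.scaleR_right

lemmas rin_simps = rin.add_left rin.add_right rin.diff_left rin.diff_right
  rin.minus_left rin.minus_right rin.scaleR_left rin.scaleR_right rin.zero_left rin.zero_right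

lemmas comp_simps = bounded_bilinear.add_left[OF bounded_bilinear_blinfun_compose]
  bounded_bilinear.add_right[OF bounded_bilinear_blinfun_compose]
  bounded_bilinear.diff_left[OF bounded_bilinear_blinfun_compose]
  bounded_bilinear.diff_right[OF bounded_bilinear_blinfun_compose]
  bounded_bilinear.minus_left[OF bounded_bilinear_blinfun_compose]
  bounded_bilinear.minus_right[OF bounded_bilinear_blinfun_compose]
  bounded_bilinear.scaleR_left[OF bounded_bilinear_blinfun_compose]
  bounded_bilinear.scaleR_right[OF bounded_bilinear_blinfun_compose]

lemma comp_id: "id_blinfun o\<^sub>L A = A" "A o\<^sub>L id_blinfun = A"
  by (rule blinfun_eqI, simp)+

lemma comp_assoc: "(A o\<^sub>L B) o\<^sub>L C = A o\<^sub>L (B o\<^sub>L C)"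
  by (rule blinfun_eqI) simp

definition sa :: "('h::complex_hilbert \<Rightarrow>\<^sub>L 'h) \<Rightarrow> bool" where
  "sa T \<longleftrightarrow> (\<forall>x y. rin (T x) y = rin x (T y))"

definition nn :: "('h::complex_hilbert \<Rightarrow>\<^sub>L 'h) \<Rightarrow> bool" where
  "nn T \<longleftrightarrow> sa T \<and> (\<forall>x. 0 \<le> rin x (T x))"

lemma saD: "sa T \<Longrightarrow> rin (T x) y = rin x (T y)"
  by (simp add: sa_def)

lemma nn_imp_sa: "nn T \<Longrightarrow> sa T"
  by (simp add: nn_def)

lemma nnD: "nn T \<Longrightarrow> 0 \<le> rin x (T x)"
  by (simp add: nn_def)

lemma sa_zero [simp]: "sa 0" and sa_id [simp]: "sa id_blinfun"
  by (simp_all add: sa_def op_simps rin_simps)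

lemma sa_add: "sa S \<Longrightarrow> sa T \<Longrightarrow> sa (S + T)"
  and sa_diff: "sa S \<Longrightarrow> sa T \<Longrightarrow> sa (S - T)"
  and sa_scaleR: "sa T \<Longrightarrow> sa (r *\<^sub>R T)"
  by (simp_all add: sa_def op_simps rin_simps)

lemma sa_comp: "sa S \<Longrightarrow> sa T \<Longrightarrow> S o\<^sub>L T = T o\<^sub>L S \<Longrightarrow> sa (S o\<^sub>L T)"
  unfolding sa_def by (metis blinfun_apply_blinfun_compose)

lemma nn_zero [simp]: "nn 0" and nn_id [simp]: "nn id_blinfun"
  by (simp_all add: nn_def op_simps rin_simps rin_self)

lemma nn_add: "nn S \<Longrightarrow> nn T \<Longrightarrow> nn (S + T)"
  by (simp add: nn_def sa_add op_simps rin_simps)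

lemma nn_scaleR: "nn T \<Longrightarrow> 0 \<le> r \<Longrightarrow> nn (r *\<^sub>R T)"
  by (simp add: nn_def sa_scaleR op_simps rin_simps)

lemma nn_sandwich: "nn A \<Longrightarrow> sa B \<Longrightarrow> nn (B o\<^sub>L A o\<^sub>L B)"
  unfolding nn_def sa_def by (metis blinfun_apply_blinfun_compose)

lemma nn_square:
  assumes "sa B"
  shows "nn (B o\<^sub>L B)"
proof -
  have "0 \<le> rin x (B (B x))" for x
    by (simp add: rin_self flip: saD[OF assms, of x "B x"])
  then show ?thesis
    using assms by (simp add: nn_def sa_comp)
qed

lemma nn_diff_trans: "nn (A - B) \<Longrightarrow> nn (B - C) \<Longrightarrow> nn (A - C)"
  using nn_add[of "A - B" "B - C"] by simp

text \<open>A non-zero skew operator also has vanishing real quadratic form, so self-adjointness is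
  essential. Evaluating the form at \<open>A x + x\<close> and cancelling leaves 2 |A x|^2 =
  0.\<close>

lemma quadratic_form_eq_0:
  assumes "sa A" and "\<And>h. rin h (A h) = 0"
  shows "A = 0"
proof (rule blinfun_eqI)
  fix x
  have "rin (A x + x) (A (A x + x)) = 0"
    by (rule assms(2))
  then have "rin (A x) (A x) = 0"
    using assms(2) saD[OF assms(1), of x "A x"]
    by (simp add: op_simps rin_simps)
  then show "A x = blinfun_apply 0 x"
    by (simp add: rin_self op_simps)
qed

lemma nn_antisym:
  assumes "nn (A - B)" "nn (B - A)"
  shows "A = B"
proof -
  have "A - B = 0"
  proof (rule quadratic_form_eq_0)
    show "rin h ((A - B) h) = 0" for h
      using nnD[OF assms(1), of h] nnD[OF assms(2), of h] by (simp add: op_simps rin_simps)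
  qed (simp add: assms nn_imp_sa)
  then show ?thesis by simp
qed

text \<open>\<open>A\<^sup>2 \<le> A\<close>, because \<open>A - A\<^sup>2 = (1 - A) A (1 - A) + A (1 - A) A\<close>.\<close>

lemma nn_diff_square:
  assumes "nn A" "nn (id_blinfun - A)"
  shows "nn (A - (A o\<^sub>L A))"
proof -
  let ?B = "id_blinfun - A"
  have "A - (A o\<^sub>L A) = (?B o\<^sub>L A o\<^sub>L ?B) + (A o\<^sub>L ?B o\<^sub>L A)"
    by (rule blinfun_eqI) (simp add: op_simps)
  then show ?thesis
    by (simp add: assms nn_add nn_sandwich nn_imp_sa)
qed

text \<open>This inequality turns convergence of quadratic forms into norm convergence of vectors,
  in \<open>monotone_strong_limit_exists\<close>.\<close>

lemma norm_square_le_quadratic_form: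
  assumes "nn A" "nn (id_blinfun - A)"
  shows "(norm (A h))\<^sup>2 \<le> rin h (A h)"
  using nnD[OF nn_diff_square[OF assms], of h]
  by (simp add: op_simps rin_simps flip: rin_self saD[OF nn_imp_sa[OF assms(1)], of h "A h"])

lemma norm_le_of_nn_le_id:
  assumes "nn A" "nn (id_blinfun - A)"
  shows "norm A \<le> 1"
proof (rule norm_blinfun_bound)
  fix h
  have "(norm (A h))\<^sup>2 \<le> rin h (A h)"
    by (rule norm_square_le_quadratic_form[OF assms])
  also have "\<dots> \<le> (norm h)\<^sup>2"
    using nnD[OF assms(2), of h] by (simp add: op_simps rin_simps rin_self)
  finally show "norm (A h) \<le> 1 * norm h"
    by simp
qed simp

lemma nn_norm_diff:
  assumes "sa A" and "norm A \<le> r"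
  shows "nn (r *\<^sub>R id_blinfun - A)"
  unfolding nn_def
proof (intro conjI allI)
  fix h
  have "rin h (A h) \<le> norm h * norm (A h)"
    by (rule rin_le_norm)
  also have "\<dots> \<le> norm h * (r * norm h)"
    by (meson assms(2) norm_blinfun norm_ge_zero mult_left_mono mult_right_mono order_trans)
  finally show "0 \<le> rin h ((r *\<^sub>R id_blinfun - A) h)"
    by (simp add: op_simps rin_simps rin_self power2_eq_square mult.left_commute)
qed (simp add: assms sa_diff sa_scaleR)

text \<open>
  For \<open>0 \<le> A \<le> 1\<close> the recursion \<open>A\<^sub>0 = A\<close>, \<open>A\<^sub>n\<^sub>+\<^sub>1 = A\<^sub>n - A\<^sub>n\<^sup>2\<close> writes \<open>A\<close> as the sum of the
  squares \<open>A\<^sub>n\<^sup>2\<close>, so that \<open>A B\<close> is the sum of the \<open>A\<^sub>n B A\<^sub>n\<close>.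
\<close>

lemma nn_comp_le_id:
  assumes A: "nn A" "nn (id_blinfun - A)" and B: "nn B" and comm: "A o\<^sub>L B = B o\<^sub>L A"
  shows "nn (A o\<^sub>L B)"
proof -
  define X where "X = rec_nat A (\<lambda>_ T. T - (T o\<^sub>L T))"
  have X0: "X 0 = A" and XS: "X (Suc n) = X n - (X n o\<^sub>L X n)" for n
    by (simp_all add: X_def)
  have X: "nn (X n) \<and> nn (id_blinfun - X n) \<and> X n o\<^sub>L B = B o\<^sub>L X n" for n
  proof (induction n)
    case 0
    then show ?case using A comm by (simp add: X0)
  next
    case (Suc n)
    have "id_blinfun - X (Suc n) = (id_blinfun - X n) + (X n o\<^sub>L X n)"
      by (simp add: XS)
    then have "nn (id_blinfun - X (Suc n))"
      using Suc nn_add nn_square nn_imp_sa by metis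
    moreover have "X (Suc n) o\<^sub>L B = B o\<^sub>L X (Suc n)"
    proof -
      have "(X n o\<^sub>L X n) o\<^sub>L B = B o\<^sub>L (X n o\<^sub>L X n)"
        using Suc by (metis comp_assoc)
      then show ?thesis
        using Suc by (simp add: XS comp_simps)
    qed
    ultimately show ?case
      using Suc by (simp add: XS nn_diff_square)
  qed
  have XB: "X n (B h) = B (X n h)" for n h
    by (metis X blinfun_apply_blinfun_compose)
  have saX: "rin (X n x) y = rin x (X n y)" for n x y
    using X nn_imp_sa saD by blast
  have "0 \<le> rin h (A (B h))" for h
  proof -
    \<comment> \<open>The recursion telescopes: |X k h|^2 is the decrease of
      \<open>rin h (X k h)\<close> at step k. The sums stay below \<open>rin h (A h)\<close>, so
      \<open>X k h\<close> tends to 0.\<close>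
    have sq: "(\<Sum>k<n. (norm (X k h))\<^sup>2) = rin h (A h) - rin h (X n h)" for n
      by (induction n) (simp_all add: X0 XS op_simps rin_simps saX flip: rin_self)
    have "summable (\<lambda>k. (norm (X k h))\<^sup>2)"
    proof (rule summableI_nonneg_bounded)
      show "(\<Sum>k<n. (norm (X k h))\<^sup>2) \<le> rin h (A h)" for n
        using X nnD[of "X n" h] by (simp add: sq)
    qed simp
    then have "(\<lambda>k. (norm (X k h))\<^sup>2) \<longlonglongrightarrow> 0"
      by (rule summable_LIMSEQ_zero)
    then have "(\<lambda>k. sqrt ((norm (X k h))\<^sup>2)) \<longlonglongrightarrow> sqrt 0"
      by (rule tendsto_real_sqrt)
    then have "(\<lambda>k. norm (X k h)) \<longlonglongrightarrow> 0"
      by simp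
    then have Xh: "(\<lambda>k. X k h) \<longlonglongrightarrow> 0"
      by (rule tendsto_norm_zero_cancel)
    have "(\<lambda>k. rin h (B (X k h))) \<longlonglongrightarrow> rin h (B 0)"
      by (intro rin.tendsto tendsto_const blinfun.tendsto Xh)
    then have lim: "(\<lambda>k. rin h (B (X k h))) \<longlonglongrightarrow> 0"
      by (simp add: op_simps rin_simps)
    \<comment> \<open>The left side decreases in \<open>n\<close>, by
      \<open>rin (X n h) (B (X n h))\<close> at each step, and tends to 0 by \<open>lim\<close>; at
      \<open>n = 0\<close> it equals the right side.\<close>
    have "rin h (B (X n h)) \<le> rin h (A (B h))" for n
    proof (induction n)
      case 0
      then show ?case using XB[of 0 h] by (simp add: X0)
    next
      case (Suc n)
      have "0 \<le> rin (X n h) (B (X n h))"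
        using B by (rule nnD)
      then have "rin h (B (X (Suc n) h)) \<le> rin h (B (X n h))"
        by (simp add: XS op_simps rin_simps saX XB)
      then show ?case using Suc by simp
    qed
    then show ?thesis
      by (intro LIMSEQ_le_const2[OF lim]) auto
  qed
  then show ?thesis
    using A B sa_comp[OF _ _ comm] unfolding nn_def by simp
qed

lemma nn_comp:
  assumes A: "nn A" and B: "nn B" and comm: "A o\<^sub>L B = B o\<^sub>L A"
  shows "nn (A o\<^sub>L B)"
proof -
  define r where "r = norm A + 1"
  have r: "r > 0"
    by (simp add: r_def add_nonneg_pos)
  let ?A = "(1 / r) *\<^sub>R A"
  have "nn (?A o\<^sub>L B)"
  proof (rule nn_comp_le_id)
    have "nn ((1 / r) *\<^sub>R (r *\<^sub>R id_blinfun - A))"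
      using r A by (intro nn_scaleR nn_norm_diff) (auto simp: r_def nn_imp_sa)
    then show "nn (id_blinfun - ?A)"
      using r by (simp add: scaleR_diff_right)
  qed (use r A B comm in \<open>simp_all add: nn_scaleR comp_simps\<close>)
  then have "nn (r *\<^sub>R (?A o\<^sub>L B))"
    using r by (intro nn_scaleR) auto
  then show ?thesis
    using r by (simp add: comp_simps)
qed

section \<open>Strong limits\<close>

text \<open>The norm bound belongs to the notion because it makes the operator product jointly
  continuous and strong convergence stronger than weak* convergence. Filters are used because chains
  of projections may be uncountable.\<close>

definition strong_limit ::
    "'i filter \<Rightarrow> ('i \<Rightarrow> 'h::complex_hilbert \<Rightarrow>\<^sub>L 'h) \<Rightarrow> ('h \<Rightarrow>\<^sub>L 'h) \<Rightarrow> bool" where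
  "strong_limit F T S \<longleftrightarrow>
     (\<exists>C. \<forall>\<^sub>F i in F. norm (T i) \<le> C) \<and> (\<forall>h. ((\<lambda>i. T i h) \<longlongrightarrow> S h) F)"

lemma strong_limit_const [simp]: "strong_limit F (\<lambda>_. S) S"
  by (auto simp: strong_limit_def intro: exI[of _ "norm S"])

lemma strong_limit_scaleR:
  assumes "strong_limit F T S"
  shows "strong_limit F (\<lambda>i. r *\<^sub>R T i) (r *\<^sub>R S)"
proof -
  obtain C where "\<forall>\<^sub>F i in F. norm (T i) \<le> C"
    using assms by (auto simp: strong_limit_def)
  then have "\<forall>\<^sub>F i in F. norm (r *\<^sub>R T i) \<le> \<bar>r\<bar> * C"
    by eventually_elim (simp add: mult_left_mono)
  then show ?thesis
    using assms unfolding strong_limit_def by (auto simp: op_simps intro!: tendsto_add tendsto_scaleR tendsto_const)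
qed

lemma strong_limit_add:
  assumes "strong_limit F T S" "strong_limit F T' S'"
  shows "strong_limit F (\<lambda>i. T i + T' i) (S + S')"
proof -
  obtain C C' where "\<forall>\<^sub>F i in F. norm (T i) \<le> C" "\<forall>\<^sub>F i in F. norm (T' i) \<le> C'"
    using assms by (auto simp: strong_limit_def)
  then have "\<forall>\<^sub>F i in F. norm (T i + T' i) \<le> C + C'"
    by eventually_elim (meson add_mono norm_triangle_le)
  then show ?thesis
    using assms unfolding strong_limit_def by (auto simp: op_simps intro!: tendsto_add tendsto_scaleR tendsto_const)
qed

lemma strong_limit_diff:
  assumes "strong_limit F T S" "strong_limit F T' S'"
  shows "strong_limit F (\<lambda>i. T i - T' i) (S - S')"
  using strong_limit_add[OF assms(1) strong_limit_scaleR[OF assms(2), of "-1"]] by simp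

text \<open>Split \<open>T i (T' i h)\<close> as T_i (T'_i h - S' h) + T_i (S' h); the bound on the
  \<open>T i\<close> makes the first term vanish in the limit.\<close>

lemma strong_limit_comp:
  assumes "strong_limit F T S" "strong_limit F T' S'"
  shows "strong_limit F (\<lambda>i. T i o\<^sub>L T' i) (S o\<^sub>L S')"
proof -
  obtain C C' where C: "\<forall>\<^sub>F i in F. norm (T i) \<le> C" and C': "\<forall>\<^sub>F i in F. norm (T' i) \<le> C'"
    using assms by (auto simp: strong_limit_def)
  have "\<forall>\<^sub>F i in F. norm (T i o\<^sub>L T' i) \<le> C * C'"
    using C C' by eventually_elim
      (meson mult_mono norm_blinfun_compose norm_ge_zero order_trans)
  moreover have "((\<lambda>i. T i (T' i h)) \<longlongrightarrow> S (S' h)) F" for h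
  proof -
    have "((\<lambda>i. T i (T' i h - S' h)) \<longlongrightarrow> 0) F"
    proof (rule Lim_null_comparison)
      show "\<forall>\<^sub>F i in F. norm (T i (T' i h - S' h)) \<le> C * norm (T' i h - S' h)"
        using C by eventually_elim
          (meson mult_right_mono norm_blinfun norm_ge_zero order_trans)
      have "((\<lambda>i. C * norm (T' i h - S' h)) \<longlongrightarrow> C * norm (S' h - S' h)) F"
        using assms(2)
        by (intro tendsto_mult tendsto_norm tendsto_diff tendsto_const) (simp add: strong_limit_def)
      then show "((\<lambda>i. C * norm (T' i h - S' h)) \<longlongrightarrow> 0) F"
        by simp
    qed
    moreover have "((\<lambda>i. T i (S' h)) \<longlongrightarrow> S (S' h)) F"
      using assms(1) by (auto simp: strong_limit_def)
    ultimately have "((\<lambda>i. T i (T' i h - S' h) + T i (S' h)) \<longlongrightarrow> 0 + S (S' h)) F"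
      by (rule tendsto_add)
    then show ?thesis
      by (simp add: op_simps)
  qed
  ultimately show ?thesis
    by (auto simp: strong_limit_def)
qed

lemma strong_limit_unique:
  "F \<noteq> bot \<Longrightarrow> strong_limit F T S \<Longrightarrow> strong_limit F T S' \<Longrightarrow> S = S'"
  unfolding strong_limit_def by (metis blinfun_eqI tendsto_unique)

lemma strong_limit_comm:
  assumes "F \<noteq> bot" "strong_limit F T S" "\<And>i. T i o\<^sub>L B = B o\<^sub>L T i"
  shows "S o\<^sub>L B = B o\<^sub>L S"
proof -
  have "strong_limit F (\<lambda>i. T i o\<^sub>L B) (S o\<^sub>L B)" "strong_limit F (\<lambda>i. B o\<^sub>L T i) (B o\<^sub>L S)"
    using assms(2) by (intro strong_limit_comp strong_limit_const; simp)+
  then show ?thesis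
    using assms(1,3) strong_limit_unique by fastforce
qed

lemma strong_limit_sa:
  assumes "F \<noteq> bot" "strong_limit F T S" "\<forall>\<^sub>F i in F. sa (T i)"
  shows "sa S"
  unfolding sa_def
proof (intro allI)
  fix x y
  have T: "((\<lambda>i. T i h) \<longlongrightarrow> S h) F" for h
    using assms(2) by (simp add: strong_limit_def)
  have "((\<lambda>i. rin (T i x) y) \<longlongrightarrow> rin (S x) y) F" "((\<lambda>i. rin x (T i y)) \<longlongrightarrow> rin x (S y)) F"
    by (intro rin.tendsto tendsto_const T)+
  moreover have "\<forall>\<^sub>F i in F. rin (T i x) y = rin x (T i y)"
    using assms(3) by eventually_elim (rule saD)
  ultimately show "rin (S x) y = rin x (S y)"
    using assms(1) tendsto_cong tendsto_unique by fast
qed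

lemma strong_limit_nn:
  assumes "F \<noteq> bot" "strong_limit F T S" "\<forall>\<^sub>F i in F. nn (T i)"
  shows "nn S"
  unfolding nn_def
proof (intro conjI allI)
  have "\<forall>\<^sub>F i in F. sa (T i)"
    using assms(3) by eventually_elim (rule nn_imp_sa)
  then show "sa S"
    using assms strong_limit_sa by blast
  fix x
  have T: "((\<lambda>i. T i h) \<longlongrightarrow> S h) F" for h
    using assms(2) by (simp add: strong_limit_def)
  have "((\<lambda>i. rin x (T i x)) \<longlongrightarrow> rin x (S x)) F"
    by (intro rin.tendsto tendsto_const T)
  moreover have "\<forall>\<^sub>F i in F. 0 \<le> rin x (T i x)"
    using assms(3) by eventually_elim (rule nnD)
  ultimately show "0 \<le> rin x (S x)"
    using assms(1) by (intro tendsto_lowerbound)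
qed

lemma strong_limit_exists:
  fixes T :: "'i \<Rightarrow> 'h::complex_hilbert \<Rightarrow>\<^sub>L 'h"
  assumes F: "F \<noteq> bot" and bnd: "\<forall>\<^sub>F i in F. norm (T i) \<le> C"
    and conv: "\<And>h. \<exists>l. ((\<lambda>i. T i h) \<longlongrightarrow> l) F"
  shows "\<exists>S. strong_limit F T S"
proof -
  obtain f where f: "((\<lambda>i. T i h) \<longlongrightarrow> f h) F" for h
    using conv by metis
  have "bounded_linear f"
  proof (rule bounded_linear_intro)
    fix x y and r :: real
    have "((\<lambda>i. T i (x + y)) \<longlongrightarrow> f x + f y) F"
      unfolding op_simps by (intro tendsto_intros f)
    then show "f (x + y) = f x + f y"
      using F f tendsto_unique by blast
    have "((\<lambda>i. T i (r *\<^sub>R x)) \<longlongrightarrow> r *\<^sub>R f x) F"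
      unfolding op_simps by (intro tendsto_intros f)
    then show "f (r *\<^sub>R x) = r *\<^sub>R f x"
      using F f tendsto_unique by blast
    show "norm (f x) \<le> norm x * C"
    proof (rule tendsto_upperbound[OF tendsto_norm[OF f] _ F])
      show "\<forall>\<^sub>F i in F. norm (T i x) \<le> norm x * C"
        using bnd by eventually_elim
          (metis mult.commute mult_right_mono norm_blinfun norm_ge_zero order_trans)
    qed
  qed
  then have "strong_limit F T (Blinfun f)"
    using bnd f by (auto simp: strong_limit_def bounded_linear_Blinfun_apply)
  then show ?thesis ..
qed

text \<open>The difference of two comparable members lies between 0 and 1, so the square of its norm
  at \<open>h\<close> is at most the difference of the quadratic forms at \<open>h\<close>. Hence
  convergent forms give Cauchy vectors. The lemma serves both increasing sequences and
  chains.\<close>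

lemma monotone_strong_limit_exists:
  fixes T :: "'i \<Rightarrow> 'h::complex_hilbert \<Rightarrow>\<^sub>L 'h"
  assumes F: "F \<noteq> bot" and I: "\<forall>\<^sub>F i in F. i \<in> I"
    and T: "\<And>i. i \<in> I \<Longrightarrow> nn (T i)" "\<And>i. i \<in> I \<Longrightarrow> nn (id_blinfun - T i)"
    and comparable: "\<And>i j. i \<in> I \<Longrightarrow> j \<in> I \<Longrightarrow> nn (T i - T j) \<or> nn (T j - T i)"
    and conv: "\<And>h. \<exists>l. ((\<lambda>i. rin h (T i h)) \<longlongrightarrow> l) F"
  shows "\<exists>S. strong_limit F T S"
proof (rule strong_limit_exists[OF F])
  show "\<forall>\<^sub>F i in F. norm (T i) \<le> 1"
    using I by eventually_elim (simp add: T norm_le_of_nn_le_id)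
  fix h
  have le: "(norm (T i h - T j h))\<^sup>2 \<le> rin h (T i h) - rin h (T j h)"
    if "i \<in> I" "j \<in> I" "nn (T i - T j)" for i j
  proof -
    have "nn (id_blinfun - (T i - T j))"
      using nn_add[OF T(2)[OF that(1)] T(1)[OF that(2)]] by (simp add: algebra_simps)
    from norm_square_le_quadratic_form[OF that(3) this, of h]
    show ?thesis by (simp add: op_simps rin_simps)
  qed
  have bound: "(norm (T i h - T j h))\<^sup>2 \<le> \<bar>rin h (T i h) - rin h (T j h)\<bar>"
    if "i \<in> I" "j \<in> I" for i j
    using comparable[OF that] le[OF that] le[OF that(2,1)] by (auto simp: norm_minus_commute)
  obtain l where l: "((\<lambda>i. rin h (T i h)) \<longlongrightarrow> l) F"
    using conv by blast
  have "cauchy_filter (filtermap (\<lambda>i. T i h) F)"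
    unfolding cauchy_filter_metric_filtermap
  proof (intro allI impI)
    fix e :: real
    assume e: "e > 0"
    \<comment> \<open>Two values within e^2/2 of \<open>l\<close> differ by less than e^2, which
      bounds the square of the distance of the vectors.\<close>
    have "\<forall>\<^sub>F i in F. dist (rin h (T i h)) l < e\<^sup>2 / 2"
      using l e by (intro tendstoD) auto
    with I have "\<forall>\<^sub>F i in F. i \<in> I \<and> dist (rin h (T i h)) l < e\<^sup>2 / 2"
      by eventually_elim simp
    moreover have "dist (T i h) (T j h) < e"
      if "i \<in> I \<and> dist (rin h (T i h)) l < e\<^sup>2 / 2" "j \<in> I \<and> dist (rin h (T j h)) l < e\<^sup>2 / 2"
      for i j
    proof -
      have "\<bar>rin h (T i h) - rin h (T j h)\<bar> < e\<^sup>2"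
        using that by (auto simp: dist_real_def abs_if split: if_splits)
      then have "(norm (T i h - T j h))\<^sup>2 < e\<^sup>2"
        using bound[of i j] that by simp
      then show ?thesis
        using e by (simp add: dist_norm power2_less_imp_less)
    qed
    ultimately show "\<exists>P. eventually P F \<and> (\<forall>x y. P x \<and> P y \<longrightarrow> dist (T x h) (T y h) < e)"
      by blast
  qed
  then obtain l where "filtermap (\<lambda>i. T i h) F \<le> nhds l"
    using cauchy_filter_complete_converges[OF _ complete_UNIV, of "filtermap (\<lambda>i. T i h) F"] F
    by (auto simp: filtermap_bot_iff)
  then show "\<exists>l. ((\<lambda>i. T i h) \<longlongrightarrow> l) F"
    by (auto simp: filterlim_def)
qed

lemma increasing_strong_limit_exists:
  fixes T :: "nat \<Rightarrow> 'h::complex_hilbert \<Rightarrow>\<^sub>L 'h"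
  assumes T: "\<And>n. nn (T n)" "\<And>n. nn (id_blinfun - T n)" and mono: "\<And>n. nn (T (Suc n) - T n)"
  shows "\<exists>S. strong_limit sequentially T S"
proof (rule monotone_strong_limit_exists[where I = UNIV])
  have le: "nn (T n - T m)" if "m \<le> n" for m n
    using that by (induction rule: dec_induct) (auto intro: nn_diff_trans mono)
  show "nn (T i - T j) \<or> nn (T j - T i)" for i j
    using le[of i j] le[of j i] linear[of i j] by blast
  fix h
  have "incseq (\<lambda>i. rin h (T i h))"
    using nnD[OF le] by (fastforce simp: incseq_def op_simps rin_simps)
  moreover have "rin h (T i h) \<le> (norm h)\<^sup>2" for i
    using nnD[OF T(2), of h i] by (simp add: op_simps rin_simps rin_self)
  ultimately show "\<exists>l. (\<lambda>i. rin h (T i h)) \<longlonglongrightarrow> l"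
    using incseq_convergent[of "\<lambda>i. rin h (T i h)" "(norm h)\<^sup>2"] by blast
qed (use T in auto)

section \<open>Spectral projections\<close>

text \<open>The closure properties shared by a JW*-algebra, its commutant centre and each of its
  corners, so that one spectral theory serves all three.\<close>

definition strong_jordan :: "('h::complex_hilbert \<Rightarrow>\<^sub>L 'h) set \<Rightarrow> bool" where
  "strong_jordan K \<longleftrightarrow> 0 \<in> K \<and> (\<forall>a\<in>K. \<forall>b\<in>K. a + b \<in> K) \<and> (\<forall>r. \<forall>a\<in>K. r *\<^sub>R a \<in> K) \<and>
     (\<forall>a\<in>K. \<forall>b\<in>K. a \<bullet>\<^sub>J b \<in> K) \<and>
     (\<forall>T S. (\<forall>n::nat. T n \<in> K) \<longrightarrow> strong_limit sequentially T S \<longrightarrow> S \<in> K)"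

lemma strong_jordanD:
  assumes "strong_jordan K"
  shows "0 \<in> K" "a \<in> K \<Longrightarrow> b \<in> K \<Longrightarrow> a + b \<in> K" "a \<in> K \<Longrightarrow> r *\<^sub>R a \<in> K"
    "a \<in> K \<Longrightarrow> b \<in> K \<Longrightarrow> a \<bullet>\<^sub>J b \<in> K"
    "(\<And>n::nat. T n \<in> K) \<Longrightarrow> strong_limit sequentially T S \<Longrightarrow> S \<in> K"
  using assms unfolding strong_jordan_def by blast+

lemma strong_jordan_diff:
  assumes "strong_jordan K" "a \<in> K" "b \<in> K"
  shows "a - b \<in> K"
  using strong_jordanD(2)[OF assms(1,2) strong_jordanD(3)[OF assms(1,3), of "-1"]] by simp

lemma jprod_comm_eq: "a o\<^sub>L b = b o\<^sub>L a \<Longrightarrow> a \<bullet>\<^sub>J b = a o\<^sub>L b"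
  by (simp add: jprod_def flip: scaleR_2)

lemma strong_jordan_comp:
  "strong_jordan K \<Longrightarrow> a \<in> K \<Longrightarrow> b \<in> K \<Longrightarrow> a o\<^sub>L b = b o\<^sub>L a \<Longrightarrow> a o\<^sub>L b \<in> K"
  using strong_jordanD(4) jprod_comm_eq by metis

lemma comp_commD: "a o\<^sub>L b = b o\<^sub>L a \<Longrightarrow> a (b h) = b (a h)"
  by (metis blinfun_apply_blinfun_compose)

lemma comp_eqD: "a o\<^sub>L b = c \<Longrightarrow> a (b h) = c h"
  by auto

lemma comp_square_comm: "a o\<^sub>L b = b o\<^sub>L a \<Longrightarrow> (a o\<^sub>L a) o\<^sub>L b = b o\<^sub>L (a o\<^sub>L a)"
  by (rule blinfun_eqI) (simp add: comp_commD)

lemma strong_limit_Suc: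
  assumes "strong_limit sequentially T S"
  shows "strong_limit sequentially (\<lambda>n. T (Suc n)) S"
proof -
  obtain C where "\<forall>\<^sub>F n in sequentially. norm (T n) \<le> C"
    using assms by (auto simp: strong_limit_def)
  then have "\<forall>\<^sub>F n in sequentially. norm (T (Suc n)) \<le> C"
    using eventually_sequentially_Suc[of "\<lambda>n. norm (T n) \<le> C"] by simp
  then show ?thesis
    using assms by (auto simp: strong_limit_def intro: LIMSEQ_Suc)
qed

definition proj :: "('h::complex_hilbert \<Rightarrow>\<^sub>L 'h) \<Rightarrow> bool" where
  "proj p \<longleftrightarrow> sa p \<and> p o\<^sub>L p = p"

lemma projD: "proj p \<Longrightarrow> sa p" "proj p \<Longrightarrow> p o\<^sub>L p = p"
  by (simp_all add: proj_def)

lemma proj_apply: "proj p \<Longrightarrow> p (p h) = p h"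
  by (metis blinfun_apply_blinfun_compose projD(2))

lemma proj_nn: "proj p \<Longrightarrow> nn p"
  using nn_square by (force simp: proj_def)

lemma proj_diff:
  assumes "proj p" "proj q" "q o\<^sub>L p = p"
  shows "p o\<^sub>L q = p" and "proj (q - p)"
proof -
  show pq: "p o\<^sub>L q = p"
  proof (rule blinfun_eqI)
    fix x
    have "rin (p (q x)) y = rin (p x) y" for y
    proof -
      have "rin (p (q x)) y = rin x (q (p y))"
        using assms by (simp add: saD projD)
      also have "q (p y) = p y"
        using assms(3) by (metis blinfun_apply_blinfun_compose)
      finally show ?thesis
        using assms by (simp add: saD projD)
    qed
    from this[of "p (q x) - p x"] have "rin (p (q x) - p x) (p (q x) - p x) = 0"
      by (simp only: rin.diff_left)
    then show "(p o\<^sub>L q) x = p x"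
      by (simp add: rin_self)
  qed
  then show "proj (q - p)"
    using assms by (simp add: proj_def sa_diff comp_simps)
qed

lemma proj_id_diff: "proj p \<Longrightarrow> proj (id_blinfun - p)"
  unfolding proj_def by (auto simp: sa_diff op_simps comp_simps intro!: blinfun_eqI)

lemma nn_id_diff_square:
  assumes "sa y" "norm y \<le> 1"
  shows "nn (id_blinfun - (y o\<^sub>L y))"
  unfolding nn_def
proof (intro conjI allI)
  fix h
  have "norm (y h) \<le> 1 * norm h"
    by (meson assms(2) mult_right_mono norm_blinfun norm_ge_zero order_trans)
  then have "(norm (y h))\<^sup>2 \<le> (norm h)\<^sup>2"
    by (simp add: power_mono)
  moreover have "rin h (y (y h)) = (norm (y h))\<^sup>2"
    using assms(1) by (metis rin_self saD)
  ultimately show "0 \<le> rin h ((id_blinfun - (y o\<^sub>L y)) h)"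
    by (simp add: op_simps rin_simps rin_self)
qed (use assms in \<open>simp add: sa_diff sa_comp\<close>)

text \<open>The range projection of \<open>0 \<le> x \<le> 1\<close> is the strong limit of \<open>1 - (1 - x)\<^sup>n\<close>.\<close>

lemma range_projection:
  fixes K :: "('h::complex_hilbert \<Rightarrow>\<^sub>L 'h) set"
  assumes K: "strong_jordan K" and x: "x \<in> K" "nn x" "nn (id_blinfun - x)"
  obtains r where "r \<in> K" "proj r" "x o\<^sub>L r = x" "\<And>B :: 'h \<Rightarrow>\<^sub>L 'h. x o\<^sub>L B = 0 \<Longrightarrow> r o\<^sub>L B = 0"
    "\<And>B. x o\<^sub>L B = B o\<^sub>L x \<Longrightarrow> r o\<^sub>L B = B o\<^sub>L r"
proof -
  \<comment> \<open>This is 1 - (1 - x)^n, written without the identity so that every term stays in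
    \<open>K\<close>.\<close>
  define R where "R = rec_nat 0 (\<lambda>_ T. T + x - (x o\<^sub>L T))"
  have R0: "R 0 = 0" and RS: "R (Suc n) = R n + x - (x o\<^sub>L R n)" for n
    by (simp_all add: R_def)
  have comm: "R n o\<^sub>L B = B o\<^sub>L R n" if B: "x o\<^sub>L B = B o\<^sub>L x" for n B
  proof (induction n)
    case (Suc n)
    show ?case
      by (rule blinfun_eqI) (simp add: RS op_simps comp_commD[OF Suc] comp_commD[OF B])
  qed (simp add: R0)
  have zero: "R n o\<^sub>L B = 0" if B: "x o\<^sub>L B = 0" for n and B :: "'h \<Rightarrow>\<^sub>L 'h"
    by (induction n) (simp_all add: R0 RS comp_simps B comp_assoc)
  have Rx: "R n o\<^sub>L x = x o\<^sub>L R n" for n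
    by (simp add: comm)
  have RK: "R n \<in> K" for n
    by (induction n)
      (simp_all add: R0 RS Rx K x strong_jordanD strong_jordan_diff strong_jordan_comp)
  have le_id: "nn (id_blinfun - R n)" for n
  proof (induction n)
    case (Suc n)
    have "id_blinfun - R (Suc n) = (id_blinfun - x) o\<^sub>L (id_blinfun - R n)"
      by (rule blinfun_eqI) (simp add: RS op_simps)
    moreover have "(id_blinfun - x) o\<^sub>L (id_blinfun - R n) = (id_blinfun - R n) o\<^sub>L (id_blinfun - x)"
      by (rule blinfun_eqI) (simp add: op_simps comp_commD[OF Rx])
    ultimately show ?case
      using Suc x(3) by (simp add: nn_comp)
  qed (simp add: R0)
  have step: "R (Suc n) - R n = x o\<^sub>L (id_blinfun - R n)" for n
    by (rule blinfun_eqI) (simp add: RS op_simps)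
  have mono: "nn (R (Suc n) - R n)" for n
    unfolding step using x(2) le_id
  proof (rule nn_comp)
    show "x o\<^sub>L (id_blinfun - R n) = (id_blinfun - R n) o\<^sub>L x"
      by (rule blinfun_eqI) (simp add: op_simps comp_commD[OF Rx])
  qed
  have nn: "nn (R n)" for n
  proof (induction n)
    case (Suc n)
    then show ?case using nn_add[OF mono[of n] Suc] by simp
  qed (simp add: R0)
  obtain r where r: "strong_limit sequentially R r"
    using increasing_strong_limit_exists[of R, OF nn le_id mono] by blast
  \<comment> \<open>The increments x (1 - R_n) of a convergent sequence tend to 0, and they also
    tend to x (1 - r).\<close>
  have "strong_limit sequentially (\<lambda>n. x o\<^sub>L (id_blinfun - R n)) (x o\<^sub>L (id_blinfun - r))"
    by (intro strong_limit_comp strong_limit_diff strong_limit_const r)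
  moreover have "strong_limit sequentially (\<lambda>n. x o\<^sub>L (id_blinfun - R n)) (r - r)"
    unfolding step[symmetric] by (intro strong_limit_diff strong_limit_Suc r)
  ultimately have x0: "x o\<^sub>L (id_blinfun - r) = 0"
    using strong_limit_unique[OF trivial_limit_sequentially] by (metis diff_self)
  have zero_r: "r o\<^sub>L B = 0" if "x o\<^sub>L B = 0" for B :: "'h \<Rightarrow>\<^sub>L 'h"
  proof -
    have "strong_limit sequentially (\<lambda>n. R n o\<^sub>L B) (r o\<^sub>L B)"
      by (intro strong_limit_comp strong_limit_const r)
    then have "strong_limit sequentially (\<lambda>n. 0) (r o\<^sub>L B)"
      using zero[OF that] by simp
    then show ?thesis
      using strong_limit_unique[OF trivial_limit_sequentially _ strong_limit_const] by metis
  qed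
  show ?thesis
  proof
    show "r \<in> K"
      using K RK r strong_jordanD(5) by blast
    show "proj r"
      unfolding proj_def
    proof
      show "sa r"
        using strong_limit_sa[OF _ r] nn by (simp add: nn_imp_sa)
      \<comment> \<open>Idempotence is the annihilation property for
        \<open>B = id_blinfun - r\<close>, an operator that may lie outside
        \<open>K\<close>.\<close>
      show "r o\<^sub>L r = r"
        using zero_r[OF x0] by (simp add: comp_simps comp_id)
    qed
    show "x o\<^sub>L r = x"
    proof (rule blinfun_eqI)
      show "(x o\<^sub>L r) h = x h" for h
        using arg_cong[OF x0, of "\<lambda>T. blinfun_apply T h"] by (simp add: op_simps)
    qed
    show "r o\<^sub>L B = B o\<^sub>L r" if "x o\<^sub>L B = B o\<^sub>L x" for B
      using strong_limit_comm[OF _ r] comm[OF that] by simp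
  qed (use zero_r in blast)
qed

text \<open>The square root is the limit of the iteration \<open>b \<mapsto> b + (x - b\<^sup>2) / 2\<close>, started at \<open>0\<close>.\<close>

lemma square_root:
  assumes K: "strong_jordan K" and x: "x \<in> K" "nn x" "nn (id_blinfun - x)"
  obtains s where "s \<in> K" "nn s" "s o\<^sub>L s = x" "\<And>B. x o\<^sub>L B = B o\<^sub>L x \<Longrightarrow> s o\<^sub>L B = B o\<^sub>L s"
proof -
  define R where "R = rec_nat 0 (\<lambda>_ T. T + (1/2) *\<^sub>R (x - (T o\<^sub>L T)))"
  have R0: "R 0 = 0" and RS: "R (Suc n) = R n + (1/2) *\<^sub>R (x - (R n o\<^sub>L R n))" for n
    by (simp_all add: R_def)
  have comm: "R n o\<^sub>L B = B o\<^sub>L R n" if B: "x o\<^sub>L B = B o\<^sub>L x" for n B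
  proof (induction n)
    case (Suc n)
    show ?case
      by (rule blinfun_eqI) (simp add: RS op_simps comp_commD[OF Suc] comp_commD[OF B])
  qed (simp add: R0)
  have RR: "R n o\<^sub>L R m = R m o\<^sub>L R n" for n m
    using comm[OF comm[symmetric]] by metis
  have RK: "R n \<in> K" for n
    by (induction n)
      (simp_all add: R0 RS K x strong_jordanD strong_jordan_diff strong_jordan_comp)
  have le_id: "nn (id_blinfun - R n)" for n
  proof (induction n)
    case (Suc n)
    have "id_blinfun - R (Suc n) =
        (1/2) *\<^sub>R (((id_blinfun - R n) o\<^sub>L (id_blinfun - R n)) + (id_blinfun - x))"
      by (rule blinfun_eqI) (simp add: RS op_simps algebra_simps flip: scaleR_add_left)
    then show ?case
      using Suc x(3) by (simp add: nn_scaleR nn_add nn_square nn_imp_sa)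
  qed (simp add: R0)
  have mono: "nn (R (Suc n) - R n)" for n
  proof (induction n)
    case 0
    then show ?case
      using x by (simp add: R0 RS nn_scaleR)
  next
    case (Suc n)
    \<comment> \<open>Subtracting two consecutive steps of the recursion and factoring the
      difference of squares exhibits twice the next increment as a product of commuting positive
      operators.\<close>
    have "nn ((R (Suc n) - R n) o\<^sub>L ((id_blinfun - R (Suc n)) + (id_blinfun - R n)))"
    proof (rule nn_comp[OF Suc nn_add[OF le_id le_id]])
      show "(R (Suc n) - R n) o\<^sub>L ((id_blinfun - R (Suc n)) + (id_blinfun - R n)) =
          ((id_blinfun - R (Suc n)) + (id_blinfun - R n)) o\<^sub>L (R (Suc n) - R n)"
        by (rule blinfun_eqI) (simp add: op_simps comp_commD[OF RR[of "Suc n" n]])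
    qed
    moreover have "2 *\<^sub>R (R (Suc (Suc n)) - R (Suc n)) =
        (R (Suc n) - R n) o\<^sub>L ((id_blinfun - R (Suc n)) + (id_blinfun - R n))"
    proof (rule blinfun_eqI)
      fix h
      have "2 *\<^sub>R (R (Suc m) - R m) = x - (R m o\<^sub>L R m)" for m
        by (simp add: RS)
      then have "2 *\<^sub>R (R (Suc (Suc n)) - R (Suc n)) =
          2 *\<^sub>R (R (Suc n) - R n) - ((R (Suc n) o\<^sub>L R (Suc n)) - (R n o\<^sub>L R n))"
        by simp
      then show "(2 *\<^sub>R (R (Suc (Suc n)) - R (Suc n))) h =
          ((R (Suc n) - R n) o\<^sub>L ((id_blinfun - R (Suc n)) + (id_blinfun - R n))) h"
        by (simp add: op_simps scaleR_2 comp_commD[OF RR[of "Suc n" n]])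
    qed
    ultimately have "nn (2 *\<^sub>R (R (Suc (Suc n)) - R (Suc n)))"
      by metis
    from nn_scaleR[OF this, of "1/2"] show ?case
      by simp
  qed
  have nn: "nn (R n)" for n
  proof (induction n)
    case (Suc n)
    then show ?case using nn_add[OF mono[of n] Suc] by simp
  qed (simp add: R0)
  obtain s where s: "strong_limit sequentially R s"
    using increasing_strong_limit_exists[of R, OF nn le_id mono] by blast
  have "strong_limit sequentially (\<lambda>n. R (Suc n) - R n) (s - s)"
    by (intro strong_limit_diff strong_limit_Suc s)
  moreover have "R (Suc n) - R n = (1/2) *\<^sub>R (x - (R n o\<^sub>L R n))" for n
    by (simp add: RS)
  ultimately have "strong_limit sequentially (\<lambda>n. (1/2) *\<^sub>R (x - (R n o\<^sub>L R n))) (s - s)"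
    by simp
  moreover have "strong_limit sequentially (\<lambda>n. (1/2) *\<^sub>R (x - (R n o\<^sub>L R n)))
      ((1/2) *\<^sub>R (x - (s o\<^sub>L s)))"
    by (intro strong_limit_scaleR strong_limit_diff strong_limit_comp strong_limit_const s)
  ultimately have "(1/2) *\<^sub>R (x - (s o\<^sub>L s)) = s - s"
    using strong_limit_unique[OF trivial_limit_sequentially] by metis
  then have ss: "s o\<^sub>L s = x"
    by simp
  show ?thesis
  proof
    show "s \<in> K"
      using K RK s strong_jordanD(5) by blast
    show "nn s"
      using strong_limit_nn[OF _ s] nn by simp
    show "s o\<^sub>L B = B o\<^sub>L s" if "x o\<^sub>L B = B o\<^sub>L x" for B
      using strong_limit_comm[OF _ s] comm[OF that] by simp
  qed (rule ss)
qed

lemma sa_square_eq_0: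
  assumes "sa P" "P o\<^sub>L (P o\<^sub>L B) = 0"
  shows "P o\<^sub>L B = 0"
proof (rule blinfun_eqI)
  fix h
  have "rin (P (B h)) (P (B h)) = rin (B h) (P (P (B h)))"
    using assms(1) by (simp add: saD)
  also have "P (P (B h)) = 0"
    using arg_cong[OF assms(2), of "\<lambda>T. blinfun_apply T h"] by simp
  finally show "(P o\<^sub>L B) h = blinfun_apply 0 h"
    by (simp add: rin_self rin_simps)
qed

text \<open>
  With \<open>s = \<bar>y\<bar>\<close>, \<open>P = (s + y) / 2\<close> and \<open>Q = (s - y) / 2\<close>, the projection \<open>c\<close> is the
  range projection of \<open>P\<^sup>2\<close>; it fixes \<open>P\<close> and annihilates \<open>Q\<close>, so \<open>c y = c s c\<close>.
\<close>

lemma positive_part_projection_le_1: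
  fixes K :: "('h::complex_hilbert \<Rightarrow>\<^sub>L 'h) set"
  assumes K: "strong_jordan K" and y: "y \<in> K" "sa y" and y1: "norm y \<le> 1"
  obtains c where "c \<in> K" "proj c" "nn (c o\<^sub>L y)" "nn ((c o\<^sub>L y) - y)"
    "\<And>B. y o\<^sub>L B = B o\<^sub>L y \<Longrightarrow> c o\<^sub>L B = B o\<^sub>L c"
proof -
  have yy: "y o\<^sub>L y \<in> K"
    using K y by (simp add: strong_jordan_comp)
  obtain s where s: "s \<in> K" "nn s" "s o\<^sub>L s = y o\<^sub>L y"
    and s_comm: "\<And>B. (y o\<^sub>L y) o\<^sub>L B = B o\<^sub>L (y o\<^sub>L y) \<Longrightarrow> s o\<^sub>L B = B o\<^sub>L s"
    using square_root[OF K yy nn_square[OF y(2)] nn_id_diff_square[OF y(2) y1]] by metis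
  have s_comm': "s o\<^sub>L B = B o\<^sub>L s" if "y o\<^sub>L B = B o\<^sub>L y" for B
    by (intro s_comm comp_square_comm that)
  have sy: "s o\<^sub>L y = y o\<^sub>L s"
    by (simp add: s_comm')
  have norm_s: "norm s \<le> 1"
  proof (rule norm_blinfun_bound)
    fix h
    have "rin (s h) (s h) = rin h ((s o\<^sub>L s) h)"
      using s(2) by (simp add: saD nn_imp_sa)
    also have "\<dots> = rin (y h) (y h)"
      unfolding s(3) using y by (simp add: saD)
    finally have "norm (s h) = norm (y h)"
      by (simp add: rin_self)
    also have "\<dots> \<le> 1 * norm h"
      by (meson y1 mult_right_mono norm_blinfun norm_ge_zero order_trans)
    finally show "norm (s h) \<le> 1 * norm h" .
  qed simp
  define P where "P = (1/2) *\<^sub>R (s + y)"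
  define Q where "Q = (1/2) *\<^sub>R (s - y)"
  have PK: "P \<in> K"
    using K s y by (simp add: P_def strong_jordanD)
  have saP: "sa P"
    using s y by (simp add: P_def sa_scaleR sa_add nn_imp_sa)
  have "norm (s + y) \<le> 2"
    using norm_triangle_ineq[of s y] y1 norm_s by simp
  then have P1: "norm P \<le> 1"
    by (simp add: P_def)
  have s_eq: "s = P + Q" and y_eq: "y = P - Q"
    by (simp_all add: P_def Q_def algebra_simps flip: scaleR_add_left)
  have PQ: "P o\<^sub>L Q = 0"
    unfolding P_def Q_def by (simp add: comp_simps s(3) sy)
  \<comment> \<open>The square is taken because \<open>P\<close> is not yet known to be positive,
    while its square is; both have the same kernel. Positivity of \<open>P\<close> comes out at the
    end, from \<open>P = c o\<^sub>L s o\<^sub>L c\<close>.\<close>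
  obtain c where c: "c \<in> K" "proj c" "(P o\<^sub>L P) o\<^sub>L c = P o\<^sub>L P"
    and c0: "\<And>B :: 'h \<Rightarrow>\<^sub>L 'h. (P o\<^sub>L P) o\<^sub>L B = 0 \<Longrightarrow> c o\<^sub>L B = 0"
    and c_comm: "\<And>B. (P o\<^sub>L P) o\<^sub>L B = B o\<^sub>L (P o\<^sub>L P) \<Longrightarrow> c o\<^sub>L B = B o\<^sub>L c"
    using range_projection[OF K strong_jordan_comp[OF K PK PK refl] nn_square[OF saP]
        nn_id_diff_square[OF saP P1]] by metis
  have cQ: "c o\<^sub>L Q = 0"
    by (rule c0) (simp add: comp_assoc PQ)
  have "P o\<^sub>L (id_blinfun - c) = 0"
  proof (rule sa_square_eq_0[OF saP], rule blinfun_eqI)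
    show "(P o\<^sub>L (P o\<^sub>L (id_blinfun - c))) h = blinfun_apply 0 h" for h
      using arg_cong[OF c(3), of "\<lambda>T. blinfun_apply T h"] by (simp add: op_simps)
  qed
  then have Pc: "P o\<^sub>L c = P"
    by (simp add: comp_simps comp_id)
  have c_comm': "c o\<^sub>L B = B o\<^sub>L c" if "y o\<^sub>L B = B o\<^sub>L y" for B
  proof (rule c_comm)
    have "P o\<^sub>L B = B o\<^sub>L P"
      using that s_comm'[OF that] by (simp add: P_def comp_simps)
    then show "(P o\<^sub>L P) o\<^sub>L B = B o\<^sub>L (P o\<^sub>L P)"
      by (rule comp_square_comm)
  qed
  have cs: "c o\<^sub>L s = s o\<^sub>L c"
    by (rule c_comm'[OF sy[symmetric]])
  have cP: "c o\<^sub>L P = P"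
    using Pc cs c_comm'[of y] by (simp add: P_def comp_simps)
  have "c o\<^sub>L y = P"
    by (simp add: y_eq comp_simps cP cQ)
  moreover have "P = c o\<^sub>L s o\<^sub>L c"
    by (simp add: s_eq comp_simps cP cQ Pc)
  ultimately have 1: "nn (c o\<^sub>L y)"
    using nn_sandwich[OF s(2) projD(1)[OF c(2)]] by simp
  let ?d = "id_blinfun - c"
  have "(c o\<^sub>L y) - y = Q"
    using \<open>c o\<^sub>L y = P\<close> y_eq by simp
  moreover have "Q = ?d o\<^sub>L s o\<^sub>L ?d"
  proof (rule blinfun_eqI)
    fix h
    have cPh: "c (P h) = P h"
      using arg_cong[OF cP, of "\<lambda>T. blinfun_apply T h"] by simp
    have csh: "c (s h) = P h"
      using arg_cong[OF cQ, of "\<lambda>T. blinfun_apply T h"] by (simp add: s_eq op_simps cPh)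
    then have "s (c h) = P h"
      using comp_commD[OF cs, of h] by metis
    moreover have "Q h = s h - P h"
      by (simp add: s_eq op_simps)
    ultimately show "Q h = (?d o\<^sub>L s o\<^sub>L ?d) h"
      by (simp add: op_simps csh cPh)
  qed
  ultimately have 2: "nn ((c o\<^sub>L y) - y)"
    using nn_sandwich[OF s(2) projD(1)[OF proj_id_diff[OF c(2)]]] by simp
  show ?thesis
    by (rule that[OF c(1,2) 1 2]) (rule c_comm')
qed

lemma positive_part_projection:
  assumes K: "strong_jordan K" and y: "y \<in> K" "sa y"
  obtains c where "c \<in> K" "proj c" "nn (c o\<^sub>L y)" "nn ((c o\<^sub>L y) - y)"
    "\<And>B. y o\<^sub>L B = B o\<^sub>L y \<Longrightarrow> c o\<^sub>L B = B o\<^sub>L c"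
proof -
  define r where "r = norm y + 1"
  have r: "r > 0"
    by (simp add: r_def add_nonneg_pos)
  let ?y = "(1 / r) *\<^sub>R y"
  have "norm ?y \<le> 1"
    using r by (simp add: r_def)
  then obtain c where c: "c \<in> K" "proj c" "nn (c o\<^sub>L ?y)" "nn ((c o\<^sub>L ?y) - ?y)"
    and comm: "\<And>B. ?y o\<^sub>L B = B o\<^sub>L ?y \<Longrightarrow> c o\<^sub>L B = B o\<^sub>L c"
    using positive_part_projection_le_1[OF K strong_jordanD(3)[OF K y(1)] sa_scaleR[OF y(2)]]
    by metis
  have "nn (r *\<^sub>R (c o\<^sub>L ?y))" "nn (r *\<^sub>R ((c o\<^sub>L ?y) - ?y))"
    using c r by (simp_all add: nn_scaleR)
  then have "nn (c o\<^sub>L y)" "nn ((c o\<^sub>L y) - y)"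
    using r by (simp_all add: comp_simps scaleR_diff_right)
  moreover have "c o\<^sub>L B = B o\<^sub>L c" if "y o\<^sub>L B = B o\<^sub>L y" for B
    by (rule comm) (simp add: comp_simps that)
  ultimately show ?thesis
    using that c(1,2) by blast
qed

section \<open>Commutators and bisection of the spectrum\<close>

lemma commutator_bound_one:
  assumes a: "sa a" and b: "f o\<^sub>L b = b o\<^sub>L f" and f: "proj f" "f o\<^sub>L a = a o\<^sub>L f"
    and bounds: "nn ((a o\<^sub>L f) - \<alpha> *\<^sub>R f)" "nn (\<beta> *\<^sub>R f - (a o\<^sub>L f))"
    and "\<alpha> \<le> \<beta>"
  shows "norm (a (b (f h)) - b (a (f h))) \<le> (\<beta> - \<alpha>) * norm b * norm (f h)"
proof -
  define \<delta> where "\<delta> = (\<beta> - \<alpha>) / 2"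
  define \<mu> where "\<mu> = (\<alpha> + \<beta>) / 2"
  \<comment> \<open>Subtracting the midpoint \<open>\<mu>\<close> leaves the commutator with
    \<open>b\<close> on the range of \<open>f\<close> unchanged, as \<open>b\<close> commutes with
    \<open>f\<close>. What remains of \<open>a\<close> has size at most \<open>\<delta>\<close>, and
    the two terms of the commutator give 2 \<delta> = \<beta> - \<alpha>.\<close>
  define y where "y = (a o\<^sub>L f) - \<mu> *\<^sub>R f"
  note bf = comp_commD[OF b] and ff = proj_apply[OF f(1)] and fa = comp_commD[OF f(2)]
  have \<delta>: "\<delta> \<ge> 0"
    using \<open>\<alpha> \<le> \<beta>\<close> by (simp add: \<delta>_def)
  have \<alpha>: "\<alpha> = \<mu> - \<delta>" and \<beta>: "\<beta> = \<mu> + \<delta>"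
    by (simp_all add: \<mu>_def \<delta>_def field_simps)
  have "sa f"
    using f projD by blast
  have "sa y"
    using f a by (simp add: y_def sa_diff sa_scaleR sa_comp projD)
  have "\<delta> *\<^sub>R f + y = (a o\<^sub>L f) - \<alpha> *\<^sub>R f" "\<delta> *\<^sub>R f - y = \<beta> *\<^sub>R f - (a o\<^sub>L f)"
    by (simp_all add: \<alpha> \<beta> y_def scaleR_diff_left scaleR_add_left)
  then have pm: "nn (\<delta> *\<^sub>R f + y)" "nn (\<delta> *\<^sub>R f - y)"
    using bounds by simp_all
  have yf: "y (f x) = y x" "f (y x) = y x" for x
    by (simp_all add: y_def op_simps ff fa)
  \<comment> \<open>The product of the commuting positive operators \<delta> f + y and \<delta> f -
    y gives y^2 \<le> \<delta>^2 f, hence the bound on |y x|.\<close>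
  have "nn ((\<delta> *\<^sub>R f + y) o\<^sub>L (\<delta> *\<^sub>R f - y))"
    by (rule nn_comp[OF pm], rule blinfun_eqI) (simp add: op_simps yf ff algebra_simps)
  moreover have "(\<delta> *\<^sub>R f + y) o\<^sub>L (\<delta> *\<^sub>R f - y) = \<delta>\<^sup>2 *\<^sub>R f - (y o\<^sub>L y)"
    by (rule blinfun_eqI) (simp add: op_simps yf ff algebra_simps power2_eq_square)
  ultimately have "0 \<le> rin x ((\<delta>\<^sup>2 *\<^sub>R f - (y o\<^sub>L y)) x)" for x
    using nnD by metis
  moreover have "rin x (y (y x)) = (norm (y x))\<^sup>2" "rin x (f x) = (norm (f x))\<^sup>2" for x
    using saD[OF \<open>sa y\<close>, of x "y x"] saD[OF \<open>sa f\<close>, of x "f x"] by (simp_all add: rin_self ff)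
  ultimately have "(norm (y x))\<^sup>2 \<le> (\<delta> * norm (f x))\<^sup>2" for x
    by (simp add: op_simps rin_simps power_mult_distrib)
  then have y_le: "norm (y x) \<le> \<delta> * norm (f x)" for x
    by (rule power2_le_imp_le) (simp add: \<delta>)
  have "a (b (f h)) - b (a (f h)) = y (b h) - b (y h)"
    by (simp add: y_def op_simps bf)
  also have "norm \<dots> \<le> norm (y (b h)) + norm (b (y h))"
    by (rule norm_triangle_ineq4)
  also have "norm (y (b h)) \<le> \<delta> * norm (b (f h))"
    using y_le[of "b h"] by (simp add: bf)
  also have "\<delta> * norm (b (f h)) \<le> \<delta> * (norm b * norm (f h))"
    by (intro mult_left_mono norm_blinfun \<delta>)
  also have "norm (b (y h)) \<le> norm b * norm (y h)"
    by (rule norm_blinfun)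
  also have "norm b * norm (y h) \<le> norm b * (\<delta> * norm (f h))"
    by (intro mult_left_mono y_le norm_ge_zero)
  finally show ?thesis
    by (simp add: \<delta>_def field_simps)
qed

text \<open>
  Bisection of the spectrum: \<open>a f\<close> differs from a multiple of \<open>f\<close> by an operator of norm at
  most \<open>(\<beta> - \<alpha>) / 2\<close>, and the commutator is block diagonal for every splitting of \<open>f\<close>.
\<close>

lemma commutator_bound:
  assumes K: "strong_jordan K" and a: "a \<in> K" "sa a"
    and b: "\<And>f. f \<in> K \<Longrightarrow> proj f \<Longrightarrow> f o\<^sub>L b = b o\<^sub>L f"
    and f: "f \<in> K" "proj f" "f o\<^sub>L a = a o\<^sub>L f"
    and bounds: "nn ((a o\<^sub>L f) - \<alpha> *\<^sub>R f)" "nn (\<beta> *\<^sub>R f - (a o\<^sub>L f))"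
    and "\<alpha> \<le> \<beta>"
  shows "norm (a (b (f h)) - b (a (f h))) \<le> (\<beta> - \<alpha>) / 2 ^ n * norm b * norm (f h)"
  using f bounds \<open>\<alpha> \<le> \<beta>\<close>
proof (induction n arbitrary: f \<alpha> \<beta> h)
  case (0 f \<alpha> \<beta> h)
  show ?case
    using commutator_bound_one[OF a(2) b[OF 0(1,2)] 0(2-6)] by simp
next
  case (Suc n f \<alpha> \<beta> h)
  define \<gamma> where "\<gamma> = (\<alpha> + \<beta>) / 2"
  define y where "y = (a o\<^sub>L f) - \<gamma> *\<^sub>R f"
  define \<epsilon> where "\<epsilon> = (\<beta> - \<alpha>) / 2 ^ Suc n * norm b"
  note fK = Suc(2) and f = Suc(3) and fa' = Suc(4)
  note bf = comp_commD[OF b[OF fK f]] and ff = proj_apply[OF f] and fa = comp_commD[OF fa']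
  have "sa y"
    using f fa' a by (simp add: y_def sa_diff sa_scaleR sa_comp projD)
  moreover have "y \<in> K"
    using K a fK fa' by (simp add: y_def strong_jordanD strong_jordan_diff strong_jordan_comp)
  ultimately obtain d where d: "d \<in> K" "proj d" "nn (d o\<^sub>L y)" "nn ((d o\<^sub>L y) - y)"
    and d_comm: "\<And>B. y o\<^sub>L B = B o\<^sub>L y \<Longrightarrow> d o\<^sub>L B = B o\<^sub>L d"
    using positive_part_projection[OF K] by metis
  have yf: "y (f x) = y x" "f (y x) = y x" for x
    by (simp_all add: y_def op_simps ff fa)
  have ya: "y (a x) = a (y x)" for x
    by (simp add: y_def op_simps fa)
  have df': "d o\<^sub>L f = f o\<^sub>L d" and da': "d o\<^sub>L a = a o\<^sub>L d"
    by (rule d_comm, rule blinfun_eqI, simp add: yf ya)+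
  note df = comp_commD[OF df'] and da = comp_commD[OF da'] and dd = proj_apply[OF d(2)]
  \<comment> \<open>The range of \<open>f\<close> is split at the midpoint: \<open>a\<close> is at
    least \<open>\<gamma>\<close> on \<open>c\<close> and at most \<open>\<gamma>\<close> on
    \<open>f - c\<close>. Both pieces are projections of \<open>K\<close> commuting with
    \<open>a\<close>, so the induction hypothesis applies to each.\<close>
  define c where "c = d o\<^sub>L f"
  have cK: "c \<in> K"
    using K d fK df' by (simp add: c_def strong_jordan_comp)
  have c: "proj c"
    unfolding proj_def c_def using d f df'
    by (auto simp: sa_comp projD df dd ff intro!: blinfun_eqI)
  have ca: "c o\<^sub>L a = a o\<^sub>L c"
    by (rule blinfun_eqI) (simp add: c_def fa da)
  have fc: "f o\<^sub>L c = c"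
    by (rule blinfun_eqI) (simp add: c_def df ff)
  have c': "proj (f - c)"
    by (rule proj_diff(2)[OF c f fc])
  have c'K: "f - c \<in> K"
    using K cK fK by (simp add: strong_jordan_diff)
  have c'a: "(f - c) o\<^sub>L a = a o\<^sub>L (f - c)"
    by (simp add: comp_simps ca fa')
  have eq1: "(a o\<^sub>L c) - \<gamma> *\<^sub>R c = d o\<^sub>L y"
    by (rule blinfun_eqI) (simp add: c_def y_def op_simps da)
  have eq2: "\<beta> *\<^sub>R c - (a o\<^sub>L c) = d o\<^sub>L (\<beta> *\<^sub>R f - (a o\<^sub>L f)) o\<^sub>L d"
    by (rule blinfun_eqI) (simp add: c_def op_simps da df dd)
  have eq3: "(a o\<^sub>L (f - c)) - \<alpha> *\<^sub>R (f - c) =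
      (id_blinfun - d) o\<^sub>L ((a o\<^sub>L f) - \<alpha> *\<^sub>R f) o\<^sub>L (id_blinfun - d)"
    by (rule blinfun_eqI) (simp add: c_def op_simps da df dd algebra_simps)
  have eq4: "\<gamma> *\<^sub>R (f - c) - (a o\<^sub>L (f - c)) = (d o\<^sub>L y) - y"
    by (rule blinfun_eqI) (simp add: c_def y_def op_simps da algebra_simps)
  have half: "(\<beta> - \<gamma>) / 2 ^ n = (\<beta> - \<alpha>) / 2 ^ Suc n" "(\<gamma> - \<alpha>) / 2 ^ n = (\<beta> - \<alpha>) / 2 ^ Suc n"
    by (simp_all add: \<gamma>_def field_simps)
  have "\<alpha> \<le> \<gamma>" "\<gamma> \<le> \<beta>"
    using \<open>\<alpha> \<le> \<beta>\<close> by (simp_all add: \<gamma>_def)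
  have "nn ((a o\<^sub>L c) - \<gamma> *\<^sub>R c)" "nn (\<beta> *\<^sub>R c - (a o\<^sub>L c))"
    unfolding eq1 eq2 by (intro d nn_sandwich Suc.prems projD(1))+
  from Suc.IH[OF cK c ca this \<open>\<gamma> \<le> \<beta>\<close>, of h]
  have 1: "norm (a (b (c h)) - b (a (c h))) \<le> \<epsilon> * norm (c h)"
    by (simp add: half \<epsilon>_def)
  have "nn ((a o\<^sub>L (f - c)) - \<alpha> *\<^sub>R (f - c))" "nn (\<gamma> *\<^sub>R (f - c) - (a o\<^sub>L (f - c)))"
    unfolding eq3 eq4 by (intro d nn_sandwich Suc.prems projD(1) proj_id_diff)+
  from Suc.IH[OF c'K c' c'a this \<open>\<alpha> \<le> \<gamma>\<close>, of h]
  have 2: "norm (a (b ((f - c) h)) - b (a ((f - c) h))) \<le> \<epsilon> * norm ((f - c) h)"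
    by (simp add: half \<epsilon>_def)
  note bc = comp_commD[OF b[OF cK c]] and ca = comp_commD[OF ca] and cc = proj_apply[OF c]
  have fc: "f (c x) = c x" "c (f x) = c x" for x
    using comp_eqD[OF fc] comp_eqD[OF proj_diff(1)[OF c f fc]] by simp_all
  \<comment> \<open>The commutator of \<open>a\<close> and \<open>b\<close> commutes with
    \<open>c\<close>, so its values at \<open>c h\<close> and \<open>(f - c) h\<close> are
    orthogonal. Their squared norms add, and the bound \<open>\<epsilon>\<close> carries over to
    \<open>f\<close> with no extra factor.\<close>
  have orth: "(norm (x + z))\<^sup>2 = (norm x)\<^sup>2 + (norm z)\<^sup>2" if "c x = x" "c z = 0" for x z
  proof -
    have "rin x z = 0"
      using saD[OF projD(1)[OF c], of x z] that by (simp add: rin_simps)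
    then show ?thesis
      using rin_commute[of z x] by (simp add: rin_simps flip: rin_self)
  qed
  let ?D = "\<lambda>x. a (b x) - b (a x)"
  have "(norm (?D (f h)))\<^sup>2 = (norm (?D (c h) + ?D ((f - c) h)))\<^sup>2"
    by (simp add: op_simps)
  also have "\<dots> = (norm (?D (c h)))\<^sup>2 + (norm (?D ((f - c) h)))\<^sup>2"
    by (rule orth) (simp_all add: op_simps ca bc cc fc)
  also have "\<dots> \<le> (\<epsilon> * norm (c h))\<^sup>2 + (\<epsilon> * norm ((f - c) h))\<^sup>2"
    using 1 2 by (intro add_mono power_mono) auto
  also have "\<dots> = \<epsilon>\<^sup>2 * ((norm (c h))\<^sup>2 + (norm ((f - c) h))\<^sup>2)"
    by (simp add: power_mult_distrib algebra_simps)
  also have "(norm (c h))\<^sup>2 + (norm ((f - c) h))\<^sup>2 = (norm (c h + (f - c) h))\<^sup>2"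
    by (rule orth[symmetric]) (simp_all add: op_simps cc fc)
  also have "c h + (f - c) h = f h"
    by (simp add: op_simps)
  finally have "(norm (?D (f h)))\<^sup>2 \<le> (\<epsilon> * norm (f h))\<^sup>2"
    by (simp add: power_mult_distrib)
  moreover have "0 \<le> \<epsilon> * norm (f h)"
    using \<open>\<alpha> \<le> \<beta>\<close> by (simp add: \<epsilon>_def)
  ultimately have "norm (?D (f h)) \<le> \<epsilon> * norm (f h)"
    by (rule power2_le_imp_le)
  then show ?case
    by (simp only: \<epsilon>_def)
qed

text \<open>Here \<open>e\<close> acts as the identity for \<open>a\<close>, and the bisection
  starts from the interval between -|a| and |a|. The bounds for the commutator form a geometric
  sequence, so it is 0.\<close>

lemma comm_of_comm_projections:
  assumes K: "strong_jordan K" and a: "a \<in> K" "sa a"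
    and e: "e \<in> K" "proj e" "a o\<^sub>L e = a" "e o\<^sub>L a = a"
    and b: "\<And>f. f \<in> K \<Longrightarrow> proj f \<Longrightarrow> f o\<^sub>L b = b o\<^sub>L f"
  shows "a o\<^sub>L b = b o\<^sub>L a"
proof (rule blinfun_eqI)
  fix h
  let ?r = "norm a"
  have "nn (?r *\<^sub>R id_blinfun - a)" "nn (?r *\<^sub>R id_blinfun - (- 1) *\<^sub>R a)"
    using a(2) by (intro nn_norm_diff sa_scaleR; simp)+
  from this[THEN nn_sandwich, OF projD(1)[OF e(2)]]
  have "nn (?r *\<^sub>R e - (a o\<^sub>L e))" "nn ((a o\<^sub>L e) - (- ?r) *\<^sub>R e)"
    by (simp_all add: comp_simps e projD comp_id add.commute)
  from commutator_bound[OF K a b e(1,2) _ this(2,1), of "e h"]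
  have "norm (a (b (e (e h))) - b (a (e (e h)))) \<le> (?r - (- ?r)) / 2 ^ n * norm b * norm (e (e h))" for n
    by (simp add: e)
  moreover have "a (b (e (e h))) = a (b h)" "a (e (e h)) = a h"
    using comp_commD[OF b[OF e(1,2)]] e(3) proj_apply[OF e(2)]
    by (metis blinfun_apply_blinfun_compose)+
  ultimately have le: "norm (a (b h) - b (a h)) \<le> (2 * ?r * norm b * norm (e (e h))) * (1/2) ^ n" for n
    by (simp add: power_divide field_simps)
  have "(\<lambda>n. (2 * ?r * norm b * norm (e (e h))) * (1/2::real) ^ n) \<longlonglongrightarrow> (2 * ?r * norm b * norm (e (e h))) * 0"
    by (intro tendsto_mult tendsto_const LIMSEQ_power_zero) simp
  then have "norm (a (b h) - b (a h)) \<le> 0"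
    using le by (intro LIMSEQ_le_const[where X = "\<lambda>n. (2 * ?r * norm b * norm (e (e h))) * (1/2) ^ n"]) auto
  then show "(a o\<^sub>L b) h = (b o\<^sub>L a) h"
    by simp
qed

section \<open>Weak* closed Jordan algebras\<close>

lemma bounded_ops_cscale: "T \<in> bounded_ops \<Longrightarrow> T (c *\<^sub>C x) = c *\<^sub>C T x"
  by (simp add: bounded_ops_def)

lemma cinner_eq_rin: "cinner x y = Complex (rin x y) (- rin x (\<i> *\<^sub>C y))"
  by (simp add: rin_def cinner_cscale_right complex_eq_iff)

lemma rin_i_left: "rin (\<i> *\<^sub>C x) y = - rin x (\<i> *\<^sub>C y)"
  by (simp add: rin_def cinner_cscale_left cinner_cscale_right)

lemma abs_rin_le: "\<bar>rin x y\<bar> \<le> norm x * norm y"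
  using rin_le_norm[of x y] rin_le_norm[of x "- y"] by (simp add: rin_simps)

lemma cmod_cinner_le: "cmod (cinner x y) \<le> 2 * (norm x * norm y)"
proof -
  have "cmod (cinner x y) \<le> \<bar>rin x y\<bar> + \<bar>rin x (\<i> *\<^sub>C y)\<bar>"
    using cmod_le[of "cinner x y"] by (simp add: cinner_eq_rin)
  also have "\<dots> \<le> norm x * norm y + norm x * norm (\<i> *\<^sub>C y)"
    by (intro add_mono abs_rin_le)
  finally show ?thesis
    by (simp add: norm_cscale)
qed

lemma tendsto_cinner:
  fixes T :: "'i \<Rightarrow> 'h::complex_hilbert \<Rightarrow>\<^sub>L 'h" and S :: "'h \<Rightarrow>\<^sub>L 'h"
  assumes T: "\<And>h. ((\<lambda>i. T i h) \<longlongrightarrow> S h) F" and "\<forall>\<^sub>F i in F. T i \<in> bounded_ops" "S \<in> bounded_ops"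
  shows "((\<lambda>i. cinner x (T i y)) \<longlongrightarrow> cinner x (S y)) F"
proof -
  have "((\<lambda>i. Complex (rin x (T i y)) (- rin x (T i (\<i> *\<^sub>C y)))) \<longlongrightarrow>
      Complex (rin x (S y)) (- rin x (S (\<i> *\<^sub>C y)))) F"
    by (intro tendsto_Complex tendsto_minus rin.tendsto tendsto_const T)
  moreover have "\<forall>\<^sub>F i in F. Complex (rin x (T i y)) (- rin x (T i (\<i> *\<^sub>C y))) = cinner x (T i y)"
    using assms(2) by eventually_elim (simp add: cinner_eq_rin bounded_ops_cscale)
  ultimately show ?thesis
    using assms(3) by (simp add: cinner_eq_rin bounded_ops_cscale tendsto_cong)
qed

lemma self_adjoint_iff_sa:
  assumes "T \<in> bounded_ops"
  shows "self_adjoint T \<longleftrightarrow> sa T"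
proof
  assume "self_adjoint T"
  then show "sa T"
    by (simp add: is_adjoint_def sa_def rin_def)
next
  assume "sa T"
  then have "rin (T x) y = rin x (T y)" "rin (T x) (\<i> *\<^sub>C y) = rin x (\<i> *\<^sub>C T y)" for x y
    using saD bounded_ops_cscale[OF assms] by metis+
  then show "self_adjoint T"
    by (simp add: is_adjoint_def cinner_eq_rin)
qed

lemma op_nonneg_iff_nn:
  assumes "T \<in> bounded_ops"
  shows "op_nonneg T \<longleftrightarrow> nn T"
proof
  assume T: "op_nonneg T"
  have real: "rin x (\<i> *\<^sub>C T x) = 0" and pos: "rin x (T x) \<ge> 0" for x
    using T unfolding op_nonneg_def by (auto simp: cinner_eq_rin complex_nonneg_Reals_iff dest: spec[of _ x])
  have minus: "(- 1) *\<^sub>C u = - u" for u :: 'a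
    using cscale_of_real[of "-1" u] by simp
  \<comment> \<open>Polarisation at x + \<i> y: a complex quadratic form with real values is
    symmetric. For \<open>rin\<close> alone this fails, which is why \<open>nn\<close> contains
    symmetry explicitly.\<close>
  have "rin x (T y) = rin y (T x)" for x y
    using real[of "x + \<i> *\<^sub>C y"] real[of x] real[of "\<i> *\<^sub>C y"]
    by (simp add: op_simps rin_simps bounded_ops_cscale[OF assms] cscale_add_right cscale_cscale
        rin_i_left minus)
  then show "nn T"
    using pos unfolding nn_def sa_def by (metis rin_commute)
next
  assume T: "nn T"
  have "rin x (\<i> *\<^sub>C T x) = 0" for x
    using saD[OF nn_imp_sa[OF T], of x "\<i> *\<^sub>C x"] rin_i_left[of x "T x"] rin_commute[of "T x" "\<i> *\<^sub>C x"]
    by (simp add: bounded_ops_cscale[OF assms])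
  then show "op_nonneg T"
    using nnD[OF T] by (simp add: op_nonneg_def cinner_eq_rin complex_nonneg_Reals_iff)
qed

lemma strong_limit_bounded_ops:
  fixes T :: "'i \<Rightarrow> 'h::complex_hilbert \<Rightarrow>\<^sub>L 'h"
  assumes "F \<noteq> bot" "strong_limit F T S" "\<forall>\<^sub>F i in F. T i \<in> bounded_ops"
  shows "S \<in> bounded_ops"
  unfolding bounded_ops_def
proof (intro CollectI allI)
  fix c x
  have T: "((\<lambda>i. T i h) \<longlongrightarrow> S h) F" for h
    using assms(2) by (simp add: strong_limit_def)
  have "bounded_linear (\<lambda>y::'h. c *\<^sub>C y)"
    by (rule bounded_linear_intro[where K = "cmod c"])
      (simp_all add: cscale_add_right cscale_scaleR norm_cscale mult.commute)
  then have "((\<lambda>i. c *\<^sub>C T i x) \<longlongrightarrow> c *\<^sub>C S x) F"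
    using T by (rule bounded_linear.tendsto)
  moreover have "\<forall>\<^sub>F i in F. c *\<^sub>C T i x = T i (c *\<^sub>C x)"
    using assms(3) by eventually_elim (simp add: bounded_ops_cscale)
  ultimately have "((\<lambda>i. T i (c *\<^sub>C x)) \<longlongrightarrow> c *\<^sub>C S x) F"
    using tendsto_cong by fast
  with T show "S (c *\<^sub>C x) = c *\<^sub>C S x"
    using assms(1) tendsto_unique by blast
qed

text \<open>The series converge term by term, and C (|x_k|^2 + |y_k|^2) is a summable majorant, so
  Tannery's theorem gives convergence of the sums. Eventual membership then passes from the
  generating sets to finite intersections and unions.\<close>

lemma limitin_weak_star:
  fixes T :: "'i \<Rightarrow> 'h::complex_hilbert \<Rightarrow>\<^sub>L 'h"
  assumes F: "F \<noteq> bot" and lim: "strong_limit F T S" and T: "\<forall>\<^sub>F i in F. T i \<in> bounded_ops"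
  shows "limitin weak_star_topology T S F"
proof -
  let ?B = "{{T \<in> bounded_ops :: ('h \<Rightarrow>\<^sub>L 'h) set. (\<Sum>n. cinner (x n) (T (y n))) \<in> U} |
    (x :: nat \<Rightarrow> 'h) (y :: nat \<Rightarrow> 'h) U.
        summable (\<lambda>n. (norm (x n))\<^sup>2) \<and> summable (\<lambda>n. (norm (y n))\<^sup>2) \<and> open U}"
  have S: "S \<in> bounded_ops"
    using F lim T by (rule strong_limit_bounded_ops)
  obtain C where C: "\<forall>\<^sub>F i in F. norm (T i) \<le> C"
    using lim by (auto simp: strong_limit_def)
  have basic: "\<forall>\<^sub>F i in F. T i \<in> V" if V_in: "V \<in> ?B" "S \<in> V" for V
  proof -
    obtain x y :: "nat \<Rightarrow> 'h" and U where V: "V = {T \<in> bounded_ops. (\<Sum>n. cinner (x n) (T (y n))) \<in> U}"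
      and x: "summable (\<lambda>n. (norm (x n))\<^sup>2)" and y: "summable (\<lambda>n. (norm (y n))\<^sup>2)" and U: "open U"
      using V_in(1) by blast
    have "((\<lambda>i. \<Sum>n. cinner (x n) (T i (y n))) \<longlongrightarrow> (\<Sum>n. cinner (x n) (S (y n)))) F"
    proof (rule tannerys_theorem[THEN conjunct2, THEN conjunct2])
      show "((\<lambda>i. cinner (x k) (T i (y k))) \<longlongrightarrow> cinner (x k) (S (y k))) F" for k
        using lim T S by (intro tendsto_cinner) (auto simp: strong_limit_def)
      have bound: "norm (cinner (x k) (T i (y k))) \<le> C * ((norm (x k))\<^sup>2 + (norm (y k))\<^sup>2)"
        if "norm (T i) \<le> C" for i k
      proof -
        have "norm (cinner (x k) (T i (y k))) \<le> 2 * (norm (x k) * norm (T i (y k)))"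
          by (rule cmod_cinner_le)
        also have "\<dots> \<le> 2 * (norm (x k) * (norm (T i) * norm (y k)))"
          by (intro mult_left_mono norm_blinfun) auto
        also have "\<dots> = norm (T i) * (2 * norm (x k) * norm (y k))"
          by simp
        also have "\<dots> \<le> norm (T i) * ((norm (x k))\<^sup>2 + (norm (y k))\<^sup>2)"
          by (intro mult_left_mono sum_squares_bound norm_ge_zero)
        also have "\<dots> \<le> C * ((norm (x k))\<^sup>2 + (norm (y k))\<^sup>2)"
          using that by (intro mult_right_mono) auto
        finally show ?thesis .
      qed
      have "\<forall>\<^sub>F i in F. \<forall>k. norm (cinner (x k) (T i (y k))) \<le> C * ((norm (x k))\<^sup>2 + (norm (y k))\<^sup>2)"
        using C by eventually_elim (use bound in blast)
      then have "\<forall>\<^sub>F z in (at_top :: nat filter) \<times>\<^sub>F F.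
          \<forall>k. norm (cinner (x k) (T (snd z) (y k))) \<le> C * ((norm (x k))\<^sup>2 + (norm (y k))\<^sup>2)"
        by (rule eventually_compose_filterlim[OF _ filterlim_snd])
      then show "\<forall>\<^sub>F (k, i) in at_top \<times>\<^sub>F F.
          norm (cinner (x k) (T i (y k))) \<le> C * ((norm (x k))\<^sup>2 + (norm (y k))\<^sup>2)"
        by eventually_elim (simp add: case_prod_beta)
      show "summable (\<lambda>k. C * ((norm (x k))\<^sup>2 + (norm (y k))\<^sup>2))"
        using x y by (intro summable_mult summable_add)
    qed (rule F)
    then have "\<forall>\<^sub>F i in F. (\<Sum>n. cinner (x n) (T i (y n))) \<in> U"
      using U V_in(2) by (auto simp: V dest: topological_tendstoD)
    with T show ?thesis
      by eventually_elim (simp add: V)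
  qed
  have "\<forall>\<^sub>F i in F. T i \<in> V" if "generate_topology_on ?B V" "S \<in> V" for V
    using that
  proof (induction rule: generate_topology_on.induct)
    case (Int a b)
    then show ?case by (simp add: eventually_conj)
  next
    case (UN K)
    then obtain k where k: "k \<in> K" "S \<in> k" "\<forall>\<^sub>F i in F. T i \<in> k"
      by blast
    from k(3) show ?case
      by eventually_elim (use k(1) in blast)
  next
    case (Basis s)
    then show ?case using basic by blast
  qed simp
  moreover have "S \<in> topspace weak_star_topology"
    unfolding weak_star_topology_def topology_generated_by_topspace
  proof (rule UnionI)
    \<comment> \<open>The zero sequences together with \<open>U = UNIV\<close> impose no condition,
      so the whole of \<open>bounded_ops\<close> is a generating set.\<close>
    show "bounded_ops \<in> ?B"
      by (intro CollectI exI[of _ "\<lambda>_. 0"] exI[of _ UNIV]) auto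
  qed (rule S)
  ultimately show ?thesis
    by (auto simp: limitin_def weak_star_topology_def openin_topology_generated_by_iff)
qed

lemma jw_star_algebraD:
  assumes "jw_star_algebra J"
  shows "J \<subseteq> bounded_ops" "closedin weak_star_topology J" "0 \<in> J"
    "a \<in> J \<Longrightarrow> b \<in> J \<Longrightarrow> a + b \<in> J" "a \<in> J \<Longrightarrow> op_cscale c a \<in> J"
    "a \<in> J \<Longrightarrow> b \<in> J \<Longrightarrow> a \<bullet>\<^sub>J b \<in> J" "adjoint_closed J"
  using assms closedin_trans_full unfolding jw_star_algebra_def von_neumann_algebra_def by blast+

text \<open>Weak* closedness of \<open>J\<close> enters here. Arbitrary filters are allowed because
  suprema of chains are limits of nets.\<close>

lemma jw_star_algebra_strong_limit:
  assumes J: "jw_star_algebra J" and F: "F \<noteq> bot" and lim: "strong_limit F T S"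
    and T: "\<forall>\<^sub>F i in F. T i \<in> J"
  shows "S \<in> J"
proof -
  have "\<forall>\<^sub>F i in F. T i \<in> bounded_ops"
    using T by eventually_elim (use jw_star_algebraD(1)[OF J] in blast)
  then have "limitin weak_star_topology T S F"
    using F lim by (intro limitin_weak_star)
  then show ?thesis
    using jw_star_algebraD(2)[OF J] T F by (intro limitin_closedin)
qed

lemma jw_star_algebra_strong_jordan:
  assumes J: "jw_star_algebra J"
  shows "strong_jordan J"
proof -
  have "r *\<^sub>R a \<in> J" if "a \<in> J" for r a
  proof -
    have "op_cscale (complex_of_real r) a = r *\<^sub>R a"
      by (rule blinfun_eqI) (simp add: op_cscale.rep_eq cscale_of_real op_simps)
    then show ?thesis
      using jw_star_algebraD(5)[OF J that] by metis
  qed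
  then show ?thesis
    using jw_star_algebraD[OF J] jw_star_algebra_strong_limit[OF J, of sequentially]
    by (auto simp: strong_jordan_def)
qed

section \<open>Projections, centre and corners\<close>

lemma projections_iff:
  assumes "J \<subseteq> bounded_ops"
  shows "p \<in> projections J \<longleftrightarrow> p \<in> J \<and> proj p"
  using assms self_adjoint_iff_sa jprod_comm_eq[of p p] unfolding projections_def proj_def by auto

lemma op_le_iff_nn:
  assumes J: "jw_star_algebra J" and "a \<in> J" "b \<in> J"
  shows "a \<preceq> b \<longleftrightarrow> nn (b - a)"
proof -
  have "b - a \<in> J"
    by (rule strong_jordan_diff[OF jw_star_algebra_strong_jordan[OF J] assms(3,2)])
  then show ?thesis
    using jw_star_algebraD(1)[OF J] by (auto simp: op_le_def op_nonneg_iff_nn)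
qed

definition commutant_centre :: "('h::complex_hilbert \<Rightarrow>\<^sub>L 'h) set \<Rightarrow> ('h \<Rightarrow>\<^sub>L 'h) set" where
  "commutant_centre J = {z \<in> J. \<forall>b\<in>J. z o\<^sub>L b = b o\<^sub>L z}"

text \<open>For a projection \<open>e\<close> of \<open>J\<close> this is the range of
  \<open>U_op e\<close> on \<open>J\<close>, described by equations that survive strong
  limits.\<close>

definition corner :: "('h::complex_hilbert \<Rightarrow>\<^sub>L 'h) set \<Rightarrow> ('h \<Rightarrow>\<^sub>L 'h) \<Rightarrow> ('h \<Rightarrow>\<^sub>L 'h) set" where
  "corner J e = {a \<in> J. e o\<^sub>L a = a \<and> a o\<^sub>L e = a}"

lemma commutant_centreD:
  "z \<in> commutant_centre J \<Longrightarrow> z \<in> J" "z \<in> commutant_centre J \<Longrightarrow> b \<in> J \<Longrightarrow> z o\<^sub>L b = b o\<^sub>L z"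
  by (auto simp: commutant_centre_def)

lemma commutant_centreI:
  "z \<in> J \<Longrightarrow> (\<And>b. b \<in> J \<Longrightarrow> z o\<^sub>L b = b o\<^sub>L z) \<Longrightarrow> z \<in> commutant_centre J"
  by (auto simp: commutant_centre_def)

text \<open>This makes the spectral projections of a self-adjoint central operator central as
  well.\<close>

lemma strong_jordan_commutant_centre:
  assumes J: "strong_jordan J"
  shows "strong_jordan (commutant_centre J)"
  unfolding strong_jordan_def
proof (intro conjI ballI allI impI)
  show "0 \<in> commutant_centre J"
    by (intro commutant_centreI strong_jordanD(1)[OF J]) simp
next
  fix a b assume ab: "a \<in> commutant_centre J" "b \<in> commutant_centre J"
  note abJ = ab[THEN commutant_centreD(1)]
  show "a + b \<in> commutant_centre J"
  proof (intro commutant_centreI strong_jordanD(2)[OF J] abJ)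
    show "(a + b) o\<^sub>L c = c o\<^sub>L (a + b)" if "c \<in> J" for c
      unfolding comp_simps ab[THEN commutant_centreD(2), OF that] ..
  qed
  have "a \<bullet>\<^sub>J b = a o\<^sub>L b"
    by (intro jprod_comm_eq commutant_centreD(2)[OF ab(1)] abJ)
  moreover have "(a o\<^sub>L b) o\<^sub>L c = c o\<^sub>L (a o\<^sub>L b)" if "c \<in> J" for c
    by (rule blinfun_eqI) (simp add: ab[THEN commutant_centreD(2), OF that, THEN comp_commD])
  ultimately show "a \<bullet>\<^sub>J b \<in> commutant_centre J"
    by (intro commutant_centreI strong_jordanD(4)[OF J] abJ) simp
next
  fix a and r :: real assume a: "a \<in> commutant_centre J"
  show "r *\<^sub>R a \<in> commutant_centre J"
  proof (intro commutant_centreI strong_jordanD(3)[OF J] commutant_centreD(1)[OF a])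
    show "(r *\<^sub>R a) o\<^sub>L c = c o\<^sub>L (r *\<^sub>R a)" if "c \<in> J" for c
      unfolding comp_simps commutant_centreD(2)[OF a that] ..
  qed
next
  fix T :: "nat \<Rightarrow> _" and S
  assume T: "\<forall>n. T n \<in> commutant_centre J" and lim: "strong_limit sequentially T S"
  show "S \<in> commutant_centre J"
  proof (rule commutant_centreI)
    show "S \<in> J"
      by (rule strong_jordanD(5)[OF J commutant_centreD(1)[OF T[rule_format]] lim])
    show "S o\<^sub>L b = b o\<^sub>L S" if "b \<in> J" for b
      by (rule strong_limit_comm[OF trivial_limit_sequentially lim
            commutant_centreD(2)[OF T[rule_format] that]])
  qed
qed

lemma strong_jordan_corner:
  assumes J: "strong_jordan J"
  shows "strong_jordan (corner J e)"
  unfolding strong_jordan_def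
proof (intro conjI ballI allI impI)
  fix a b assume "a \<in> corner J e" "b \<in> corner J e"
  then have ab: "a \<in> J" "b \<in> J" "e o\<^sub>L a = a" "a o\<^sub>L e = a" "e o\<^sub>L b = b" "b o\<^sub>L e = b"
    by (auto simp: corner_def)
  have "e o\<^sub>L (a \<bullet>\<^sub>J b) = a \<bullet>\<^sub>J b" "(a \<bullet>\<^sub>J b) o\<^sub>L e = a \<bullet>\<^sub>J b"
    by (rule blinfun_eqI; simp add: jprod_def op_simps comp_eqD[OF ab(3)] comp_eqD[OF ab(4)]
        comp_eqD[OF ab(5)] comp_eqD[OF ab(6)])+
  then show "a \<bullet>\<^sub>J b \<in> corner J e"
    using ab strong_jordanD(4)[OF J] by (simp add: corner_def)
next
  fix T :: "nat \<Rightarrow> _" and S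
  assume T: "\<forall>n. T n \<in> corner J e" and lim: "strong_limit sequentially T S"
  then have "e o\<^sub>L T n = T n" "T n o\<^sub>L e = T n" for n
    by (auto simp: corner_def)
  then have "strong_limit sequentially T (e o\<^sub>L S)" "strong_limit sequentially T (S o\<^sub>L e)"
    using strong_limit_comp[OF strong_limit_const lim, of e]
      strong_limit_comp[OF lim strong_limit_const, of e] by simp_all
  then have "e o\<^sub>L S = S" "S o\<^sub>L e = S"
    using strong_limit_unique[OF trivial_limit_sequentially _ lim] by blast+
  then show "S \<in> corner J e"
    using T lim strong_jordanD(5)[OF J, of T S] by (auto simp: corner_def)
qed (use strong_jordanD(1-4)[OF J] in \<open>simp_all add: corner_def comp_simps\<close>)

lemma commutant_centre_subset_jcentre:
  assumes J: "strong_jordan J"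
  shows "commutant_centre J \<subseteq> jcentre J"
proof
  fix z assume z: "z \<in> commutant_centre J"
  have "(z \<bullet>\<^sub>J c) \<bullet>\<^sub>J b = z \<bullet>\<^sub>J (c \<bullet>\<^sub>J b)" if "b \<in> J" "c \<in> J" for b c
    by (rule blinfun_eqI) (simp add: jprod_def op_simps scaleR_add_right
        comp_commD[OF commutant_centreD(2)[OF z that(1)]] comp_commD[OF commutant_centreD(2)[OF z that(2)]])
  then show "z \<in> jcentre J"
    using z by (simp add: jcentre_def commutant_centre_def)
qed

text \<open>
  Centrality means \<open>[[z, b], c] = 0\<close> for all \<open>b, c\<close>. So \<open>d = [z, b]\<close> commutes with \<open>J\<close>, and
  \<open>0 = [[z, b\<^sup>2], z] = 2 d [b, z]\<close> gives \<open>d\<^sup>2 = 0\<close>; since \<open>d\<close> is normal, \<open>d = 0\<close>.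
\<close>

lemma jcentre_comm:
  assumes J: "jw_star_algebra J" and z: "z \<in> jcentre J" "sa z" and b: "b \<in> J"
  shows "z o\<^sub>L b = b o\<^sub>L z"
proof -
  have zJ: "z \<in> J"
    using z by (simp add: jcentre_def)
  define D where "D b = (z o\<^sub>L b) - (b o\<^sub>L z)" for b
  have D_comm: "D b o\<^sub>L c = c o\<^sub>L D b" if "b \<in> J" "c \<in> J" for b c
  proof -
    have "4 *\<^sub>R (z \<bullet>\<^sub>J (c \<bullet>\<^sub>J b)) - 4 *\<^sub>R ((z \<bullet>\<^sub>J c) \<bullet>\<^sub>J b) = (D b o\<^sub>L c) - (c o\<^sub>L D b)"
      by (rule blinfun_eqI) (simp add: D_def jprod_def op_simps scaleR_add_right)
    moreover have "z \<bullet>\<^sub>J (c \<bullet>\<^sub>J b) = (z \<bullet>\<^sub>J c) \<bullet>\<^sub>J b"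
      using z that by (simp add: jcentre_def)
    ultimately show ?thesis
      by simp
  qed
  obtain b' where b': "b' \<in> J" "is_adjoint b' b"
    using jw_star_algebraD(7)[OF J] b by (auto simp: adjoint_closed_def)
  have adj: "rin (b' x) y = rin x (b y)" for x y
    using b'(2) by (simp add: is_adjoint_def rin_def)
  have adj': "rin (b x) y = rin x (b' y)" for x y
    by (metis adj rin_commute)
  have D_adj: "rin (D b x) y = - rin x (D b' y)" "rin (D b' x) y = - rin x (D b y)" for x y
    using z(2) by (simp_all add: D_def op_simps rin_simps adj adj' saD)
  have bb: "b o\<^sub>L b \<in> J"
    using strong_jordan_comp[OF jw_star_algebra_strong_jordan[OF J] b b] by simp
  note Dz = comp_commD[OF D_comm[OF b zJ]] and Db = comp_commD[OF D_comm[OF b b]]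
  have Dbb: "D (b o\<^sub>L b) h = D b (b h) + b (D b h)" for h
    by (simp add: D_def op_simps)
  have "D b (D b h) = 0" for h
  proof -
    have "D (b o\<^sub>L b) (z h) = z (D (b o\<^sub>L b) h)"
      by (rule comp_commD[OF D_comm[OF bb zJ]])
    then have "2 *\<^sub>R D b (b (z h)) = 2 *\<^sub>R D b (z (b h))"
      by (simp add: Dbb op_simps scaleR_2 flip: Dz Db)
    then have "D b (b (z h)) = D b (z (b h))"
      by simp
    then show ?thesis
      by (subst (2) D_def) (simp add: op_simps)
  qed
  \<comment> \<open>Up to sign \<open>D b'\<close> is the adjoint of \<open>D b\<close>. It commutes
    with \<open>z\<close> and \<open>b\<close>, hence with \<open>D b\<close>, and this is the
    normality of \<open>D b\<close>. Two uses of \<open>D_adj\<close> then pass from D(b)^2 = 0 to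
    D(b') D(b) = 0 and on to D(b) = 0.\<close>
  moreover have "D b' (D b h) = D b (D b' h)" for h
    by (subst (1 3) D_def)
      (simp add: op_simps comp_commD[OF D_comm[OF b'(1) zJ]] comp_commD[OF D_comm[OF b'(1) b]])
  ultimately have "D b' (D b x) = 0" for x
    using D_adj(2)[of "D b x" "D b' (D b x)"] rin_self[of "D b' (D b x)"]
    by (simp add: rin_simps op_simps)
  then have "D b x = 0" for x
    using D_adj(1)[of x "D b x"] rin_self[of "D b x"] by (simp add: rin_simps)
  then show ?thesis
    by (intro blinfun_eqI) (simp add: D_def op_simps)
qed

lemma jcentre_sa_commutant_centre:
  assumes "jw_star_algebra J" "z \<in> jcentre J" "sa z"
  shows "z \<in> commutant_centre J"
  using assms jcentre_comm by (auto simp: commutant_centre_def jcentre_def)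

section \<open>Small projections\<close>

lemma rin_eqI:
  assumes "\<And>y. rin u y = rin v y"
  shows "u = v"
proof -
  have "rin (u - v) (u - v) = 0"
    using assms[of "u - v"] by (simp only: rin.diff_left)
  then show ?thesis
    by (simp add: rin_self)
qed

text \<open>On the kernel of \<open>q\<close> one has |p y|^2 = (y, p y) \<le> (y, q y) = 0, so p (1
  - q) = 0; taking adjoints gives q p = p.\<close>

lemma proj_le_iff:
  assumes "proj p" "proj q"
  shows "nn (q - p) \<longleftrightarrow> q o\<^sub>L p = p"
proof
  assume le: "nn (q - p)"
  have p0: "p (x - q x) = 0" for x
  proof -
    let ?y = "x - q x"
    have "rin ?y (q ?y) = 0"
      using proj_apply[OF assms(2)] by (simp add: op_simps rin_simps)
    moreover have "rin ?y (p ?y) = (norm (p ?y))\<^sup>2"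
      using saD[OF projD(1)[OF assms(1)], of ?y "p ?y"] proj_apply[OF assms(1), of ?y]
      by (simp add: rin_self)
    ultimately have "(norm (p ?y))\<^sup>2 \<le> 0"
      using nnD[OF le, of ?y] by (simp only: op_simps rin_simps)
    then show ?thesis
      by simp
  qed
  then have pq: "p (q x) = p x" for x
    by (simp add: op_simps)
  have "rin (q (p x)) y = rin (p x) y" for x y
    using assms by (simp add: saD projD pq)
  then show "q o\<^sub>L p = p"
    by (intro blinfun_eqI) (simp add: rin_eqI)
next
  assume "q o\<^sub>L p = p"
  then show "nn (q - p)"
    using assms by (intro proj_nn proj_diff)
qed

lemma proj_add:
  assumes "proj p" "proj q" "p o\<^sub>L q = 0" "q o\<^sub>L p = 0"
  shows "proj (p + q)"
  using assms by (simp add: proj_def sa_add comp_simps)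

lemma proj_comp:
  assumes "proj p" "proj q" "p o\<^sub>L q = q o\<^sub>L p"
  shows "proj (p o\<^sub>L q)"
proof -
  have "(p o\<^sub>L q) o\<^sub>L (p o\<^sub>L q) = p o\<^sub>L q"
    by (rule blinfun_eqI)
      (simp add: comp_commD[OF assms(3)] proj_apply[OF assms(1)] proj_apply[OF assms(2)])
  then show ?thesis
    using assms by (simp add: proj_def sa_comp)
qed

lemma U_op_proj:
  assumes "e o\<^sub>L e = e"
  shows "U_op e x = e o\<^sub>L x o\<^sub>L e"
  by (rule blinfun_eqI)
    (simp add: U_op_def jprod_def op_simps scaleR_add_right comp_eqD[OF assms] algebra_simps flip: scaleR_add_left)

lemma abelian_projectionI:
  assumes J: "jw_star_algebra J" and e: "e \<in> J" "proj e"
    and comm: "\<And>a b. a \<in> corner J e \<Longrightarrow> b \<in> corner J e \<Longrightarrow> a o\<^sub>L b = b o\<^sub>L a"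
  shows "abelian_projection J e"
proof -
  have K: "strong_jordan (corner J e)"
    by (intro strong_jordan_corner jw_star_algebra_strong_jordan J)
  have ee: "e o\<^sub>L e = e"
    using e(2) by (rule projD)
  have U: "U_op e x \<in> corner J e" if "x \<in> J" for x
  proof -
    note sj = jw_star_algebra_strong_jordan[OF J]
    have "U_op e x \<in> J"
      unfolding U_op_def by (intro strong_jordan_diff[OF sj] strong_jordanD(3,4)[OF sj] e that)
    moreover have "e o\<^sub>L (e o\<^sub>L x o\<^sub>L e) = e o\<^sub>L x o\<^sub>L e" "(e o\<^sub>L x o\<^sub>L e) o\<^sub>L e = e o\<^sub>L x o\<^sub>L e"
      by (rule blinfun_eqI; simp add: proj_apply[OF e(2)])+
    ultimately show ?thesis
      by (simp add: corner_def U_op_proj[OF ee])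
  qed
  have prod: "a \<bullet>\<^sub>J b = a o\<^sub>L b" "a o\<^sub>L b \<in> corner J e" if "a \<in> corner J e" "b \<in> corner J e" for a b
    using comm[OF that] strong_jordan_comp[OF K that] by (simp_all add: jprod_comm_eq)
  have "(a \<bullet>\<^sub>J b) \<bullet>\<^sub>J c = a \<bullet>\<^sub>J (b \<bullet>\<^sub>J c)"
    if "a \<in> corner J e" "b \<in> corner J e" "c \<in> corner J e" for a b c
    using that by (simp add: prod comp_assoc)
  then show ?thesis
    using U e jw_star_algebraD(1)[OF J] by (auto simp: abelian_projection_def projections_iff)
qed

text \<open>
  If every subprojection of \<open>e\<close> is cut out by a central projection, all projections of the corner
  commute with the corner, hence so do their limits, which make up the corner.
\<close>

lemma abelian_projection_of_central:
  assumes J: "jw_star_algebra J" and e: "e \<in> J" "proj e"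
    and central: "\<And>f. f \<in> J \<Longrightarrow> proj f \<Longrightarrow> e o\<^sub>L f = f \<Longrightarrow> \<exists>c\<in>commutant_centre J. f = c o\<^sub>L e"
  shows "abelian_projection J e"
proof (rule abelian_projectionI[OF J e])
  have K: "strong_jordan (corner J e)"
    by (intro strong_jordan_corner jw_star_algebra_strong_jordan J)
  have eK: "e \<in> corner J e"
    using e by (simp add: corner_def projD)
  have proj_comm: "f o\<^sub>L b = b o\<^sub>L f" if f: "f \<in> corner J e" "proj f" and b: "b \<in> corner J e" for f b
  proof -
    obtain c where c: "c \<in> commutant_centre J" "f = c o\<^sub>L e"
      using central f by (auto simp: corner_def)
    have b': "e o\<^sub>L b = b" "b o\<^sub>L e = b" "c o\<^sub>L b = b o\<^sub>L c"
      using b c by (auto simp: corner_def commutant_centre_def)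
    have ce: "c o\<^sub>L e = e o\<^sub>L c"
      using c e by (auto simp: commutant_centre_def)
    show ?thesis
      by (rule blinfun_eqI) (simp add: c(2) comp_commD[OF ce] comp_commD[OF b'(3)] comp_eqD[OF b'(1)]
          comp_eqD[OF b'(2)] flip: comp_commD[OF b'(3)])
  qed
  have sa_comm: "a o\<^sub>L b = b o\<^sub>L a" if "a \<in> corner J e" "sa a" "b \<in> corner J e" for a b
    using that e by (intro comm_of_comm_projections[OF K that(1,2) eK e(2)] proj_comm)
      (auto simp: corner_def)
  fix a b assume a: "a \<in> corner J e" and b: "b \<in> corner J e"
  then have aJ: "a \<in> J" "b \<in> J"
    by (auto simp: corner_def)
  have ae: "e (a h) = a h" "a (e h) = a h" for h
    using a by (auto simp: corner_def comp_eqD)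
  obtain a' where a': "a' \<in> J" "is_adjoint a' a"
    using jw_star_algebraD(7)[OF J] aJ by (auto simp: adjoint_closed_def)
  have adj: "rin (a' x) y = rin x (a y)" for x y
    using a'(2) by (simp add: is_adjoint_def rin_def)
  have adj': "rin (a x) y = rin x (a' y)" for x y
    by (metis adj rin_commute)
  have "e o\<^sub>L a' = a'" "a' o\<^sub>L e = a'"
    by (rule blinfun_eqI, rule rin_eqI, simp add: adj saD[OF projD(1)[OF e(2)]] ae)+
  then have a'K: "a' \<in> corner J e"
    using a' by (simp add: corner_def)
  have bops: "a \<in> bounded_ops" "a' \<in> bounded_ops" "b \<in> bounded_ops"
    using jw_star_algebraD(1)[OF J] aJ a' by auto
  \<comment> \<open>A general \<open>a\<close> is handled through the self-adjoint elements a + a'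
    and \<i> (a - a') of the corner, where a' is the adjoint of \<open>a\<close>.\<close>
  let ?k = "op_cscale \<i> (a - a')"
  have "(a + a') o\<^sub>L b = b o\<^sub>L (a + a')"
  proof (rule sa_comm)
    show "sa (a + a')"
      by (simp add: sa_def op_simps rin_simps adj adj')
  qed (use K a a'K b in \<open>auto intro: strong_jordanD\<close>)
  moreover have "?k o\<^sub>L b = b o\<^sub>L ?k"
  proof (rule sa_comm)
    have d: "a - a' \<in> corner J e"
      using K a a'K by (intro strong_jordan_diff)
    then have "?k \<in> J"
      using jw_star_algebraD(5)[OF J] by (simp add: corner_def)
    moreover have "e o\<^sub>L ?k = ?k" "?k o\<^sub>L e = ?k"
    proof -
      have "e ((a - a') h) = (a - a') h" "(a - a') (e h) = (a - a') h" for h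
        using d by (auto simp: corner_def comp_eqD)
      moreover have "e \<in> bounded_ops"
        using jw_star_algebraD(1)[OF J] e by auto
      ultimately show "e o\<^sub>L ?k = ?k" "?k o\<^sub>L e = ?k"
        by (auto intro!: blinfun_eqI simp: op_cscale.rep_eq bounded_ops_cscale)
    qed
    ultimately show "?k \<in> corner J e"
      by (simp add: corner_def)
    show "sa ?k"
      unfolding sa_def
    proof (intro allI)
      fix x y
      have "rin (?k x) y = - rin (a x - a' x) (\<i> *\<^sub>C y)"
        by (simp add: op_cscale.rep_eq rin_i_left op_simps)
      also have "\<dots> = rin x (a (\<i> *\<^sub>C y) - a' (\<i> *\<^sub>C y))"
        by (simp add: rin_simps adj adj')
      also have "a (\<i> *\<^sub>C y) - a' (\<i> *\<^sub>C y) = (a - a') (\<i> *\<^sub>C y)"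
        by (simp add: op_simps)
      also have "\<dots> = ?k y"
      proof -
        have "a - a' \<in> J"
          using d by (simp add: corner_def)
        then show ?thesis
          using jw_star_algebraD(1)[OF J] by (auto simp: op_cscale.rep_eq bounded_ops_cscale)
      qed
      finally show "rin (?k x) y = rin x (?k y)" .
    qed
  qed (rule b)
  ultimately have s: "(a + a') (b h) = b ((a + a') h)" and k: "?k (b h) = b (?k h)" for h
    by (blast intro: comp_commD)+
  have "(a - a') (b h) = b ((a - a') h)" for h
  proof -
    have "\<i> *\<^sub>C ((a - a') (b h)) = \<i> *\<^sub>C (b ((a - a') h))"
      using k[of h] by (simp add: op_cscale.rep_eq bounded_ops_cscale[OF bops(3)])
    then have "(- \<i>) *\<^sub>C (\<i> *\<^sub>C ((a - a') (b h))) = (- \<i>) *\<^sub>C (\<i> *\<^sub>C (b ((a - a') h)))"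
      by simp
    moreover have "1 *\<^sub>C x = x" for x :: 'a
      using cscale_of_real[of 1 x] by simp
    ultimately show ?thesis
      by (simp add: cscale_cscale)
  qed
  with s have "(a + a') (b h) + (a - a') (b h) = b ((a + a') h) + b ((a - a') h)" for h
    by simp
  then have "2 *\<^sub>R a (b h) = 2 *\<^sub>R b (a h)" for h
    by (simp add: op_simps scaleR_2)
  then show "a o\<^sub>L b = b o\<^sub>L a"
    by (intro blinfun_eqI) simp
qed

section \<open>Halving projections with respect to the trace\<close>

locale traced_jw_algebra =
  fixes J :: "('h::complex_hilbert \<Rightarrow>\<^sub>L 'h) set" and \<tau> :: "('h \<Rightarrow>\<^sub>L 'h) \<Rightarrow> ('h \<Rightarrow>\<^sub>L 'h)"
  assumes jw: "jw_star_algebra J"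
    and no_abelian: "abelian_projection J e \<Longrightarrow> e = 0"
    and trace: "centre_valued_trace J \<tau>"
begin

abbreviation "Z \<equiv> commutant_centre J"

lemma sj: "strong_jordan J"
  by (rule jw_star_algebra_strong_jordan[OF jw])

lemma Z_sj: "strong_jordan Z"
  by (rule strong_jordan_commutant_centre[OF sj])

lemma Z_J: "z \<in> Z \<Longrightarrow> z \<in> J"
  by (rule commutant_centreD)

lemma Z_comm: "z \<in> Z \<Longrightarrow> b \<in> J \<Longrightarrow> z o\<^sub>L b = b o\<^sub>L z"
  by (rule commutant_centreD)

lemma Z_comp_J: "z \<in> Z \<Longrightarrow> b \<in> J \<Longrightarrow> z o\<^sub>L b \<in> J"
  by (simp add: Z_J Z_comm sj strong_jordan_comp)

lemma Z_comp_Z: "z \<in> Z \<Longrightarrow> y \<in> Z \<Longrightarrow> z o\<^sub>L y \<in> Z"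
  by (simp add: Z_J Z_comm Z_sj strong_jordan_comp)

lemma trace_add: "x \<in> J \<Longrightarrow> y \<in> J \<Longrightarrow> \<tau> (x + y) = \<tau> x + \<tau> y"
  using trace by (simp add: centre_valued_trace_def)

lemma trace_diff:
  assumes "x \<in> J" "y \<in> J"
  shows "\<tau> (x - y) = \<tau> x - \<tau> y"
  using trace_add[OF strong_jordan_diff[OF sj assms] assms(2)] by simp

lemma trace_nn:
  assumes "x \<in> J" "nn x"
  shows "nn (\<tau> x)"
proof -
  have "\<tau> x \<in> J"
    using trace assms by (auto simp: centre_valued_trace_def jcentre_def)
  moreover have "0 \<preceq> \<tau> x"
    using trace assms op_le_iff_nn[OF jw strong_jordanD(1)[OF sj] assms(1)]
    by (simp add: centre_valued_trace_def)
  ultimately show ?thesis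
    using op_le_iff_nn[OF jw strong_jordanD(1)[OF sj]] by simp
qed

text \<open>The trace takes values in the Jordan centre; positivity makes the value self-adjoint,
  which turns the associator condition into operator commutation.\<close>

lemma trace_Z:
  assumes "x \<in> J" "nn x"
  shows "\<tau> x \<in> Z"
  using trace trace_nn[OF assms] assms
  by (intro jcentre_sa_commutant_centre[OF jw]) (auto simp: centre_valued_trace_def nn_imp_sa)

lemma trace_Z_comp:
  assumes "z \<in> Z" "x \<in> J" "nn x"
  shows "\<tau> (z o\<^sub>L x) = z o\<^sub>L \<tau> x"
proof -
  have "\<tau> (z \<bullet>\<^sub>J x) = z \<bullet>\<^sub>J \<tau> x"
    using trace assms commutant_centre_subset_jcentre[OF sj] by (auto simp: centre_valued_trace_def)
  then show ?thesis
    using assms Z_J trace_Z by (simp add: jprod_comm_eq Z_comm)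
qed

text \<open>
  For \<open>f \<le> e\<close> let the central projection \<open>c\<close> be the support of the positive part of
  \<open>\<tau> f - \<tau> (e - f)\<close>; then \<open>c (e - f) + (1 - c) f\<close> picks the smaller of \<open>f\<close> and \<open>e - f\<close>.
\<close>

lemma halving:
  assumes e: "e \<in> J" "proj e" "e \<noteq> 0"
  shows "\<exists>g\<in>J. proj g \<and> g \<noteq> 0 \<and> e o\<^sub>L g = g \<and> nn (\<tau> e - 2 *\<^sub>R \<tau> g)"
proof -
  have "\<not> abelian_projection J e"
    using e no_abelian by blast
  then obtain f where f: "f \<in> J" "proj f" "e o\<^sub>L f = f" and nf: "\<And>c. c \<in> Z \<Longrightarrow> f \<noteq> c o\<^sub>L e"
    using abelian_projection_of_central[OF jw e(1,2)] by blast
  have fe: "f o\<^sub>L e = f"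
    by (rule proj_diff(1)[OF f(2) e(2) f(3)])
  have nne: "nn e" and nnf: "nn f"
    using e f proj_nn by auto
  define y where "y = 2 *\<^sub>R \<tau> f - \<tau> e"
  have "y \<in> Z"
    unfolding y_def using e f nne nnf
    by (intro strong_jordan_diff[OF Z_sj] strong_jordanD(3)[OF Z_sj] trace_Z)
  moreover have "sa y"
    unfolding y_def using e f nne nnf by (intro sa_diff sa_scaleR nn_imp_sa trace_nn)
  ultimately obtain c where c: "c \<in> Z" "proj c" and cy: "nn (c o\<^sub>L y)" "nn ((c o\<^sub>L y) - y)"
    using positive_part_projection[OF Z_sj] by metis
  define l where "l = c o\<^sub>L e"
  define k where "k = c o\<^sub>L f"
  have ce: "c o\<^sub>L e = e o\<^sub>L c" and cf: "c o\<^sub>L f = f o\<^sub>L c"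
    by (rule Z_comm[OF c(1) e(1)], rule Z_comm[OF c(1) f(1)])
  have lJ: "l \<in> J" and kJ: "k \<in> J"
    using c e f by (simp_all add: l_def k_def Z_comp_J)
  define g where "g = f + l - 2 *\<^sub>R k"
  have gJ: "g \<in> J"
    unfolding g_def using f lJ kJ
    by (intro strong_jordan_diff[OF sj] strong_jordanD(2,3)[OF sj])
  note rules = proj_apply[OF c(2)] proj_apply[OF e(2)] proj_apply[OF f(2)] comp_eqD[OF f(3)]
    comp_eqD[OF fe] comp_commD[OF ce, symmetric] comp_commD[OF cf, symmetric]
  have "sa g"
    unfolding g_def l_def k_def using c e f ce cf
    by (intro sa_diff sa_add sa_scaleR sa_comp) (auto simp: projD)
  moreover have "g o\<^sub>L g = g"
    by (rule blinfun_eqI) (simp add: g_def l_def k_def op_simps rules scaleR_2)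
  ultimately have "proj g"
    by (simp add: proj_def)
  moreover have "e o\<^sub>L g = g"
    by (rule blinfun_eqI) (simp add: g_def l_def k_def op_simps rules)
  \<comment> \<open>If g = 0, its two orthogonal parts c (e - f) and (1 - c) f vanish, so f = c f =
    c e, against the choice of \<open>f\<close>.\<close>
  moreover have "g \<noteq> 0"
  proof
    assume "g = 0"
    have g0: "f h + c (e h) - 2 *\<^sub>R c (f h) = 0" for h
    proof -
      have "f h + c (e h) - 2 *\<^sub>R c (f h) = g h"
        by (simp add: g_def l_def k_def op_simps)
      then show ?thesis
        using \<open>g = 0\<close> by simp
    qed
    have "c (f h) = c (e h)" for h
      using arg_cong[OF g0[of h], of c] by (simp add: op_simps rules scaleR_2)
    with g0 have "f h = c (e h)" for h
      by (simp add: scaleR_2)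
    then have "f = c o\<^sub>L e"
      by (intro blinfun_eqI) simp
    with nf c show False by blast
  qed
  moreover have "nn (\<tau> e - 2 *\<^sub>R \<tau> g)"
  proof -
    have \<tau>k: "\<tau> k = c o\<^sub>L \<tau> f" and \<tau>l: "\<tau> l = c o\<^sub>L \<tau> e"
      using c e f nne nnf by (simp_all add: k_def l_def trace_Z_comp)
    have "g + (k + k) = f + l"
      by (simp add: g_def scaleR_2)
    then have "\<tau> g + (\<tau> k + \<tau> k) = \<tau> f + \<tau> l"
      using trace_add[OF gJ strong_jordanD(2)[OF sj kJ kJ]] trace_add[OF kJ kJ] trace_add[OF f(1) lJ]
      by metis
    then have \<tau>g: "\<tau> g = \<tau> f + \<tau> l - (\<tau> k + \<tau> k)"
      by (simp add: eq_diff_eq)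
    \<comment> \<open>The difference is the absolute value of \<open>y\<close>, as the sum of its
      positive and negative parts.\<close>
    have "\<tau> e - 2 *\<^sub>R \<tau> g = (c o\<^sub>L y) + ((c o\<^sub>L y) - y)"
      unfolding \<tau>g \<tau>k \<tau>l y_def by (simp add: comp_simps scaleR_2)
    then show ?thesis
      using cy by (simp add: nn_add)
  qed
  ultimately show ?thesis
    using gJ by blast
qed

lemma iterated_halving:
  assumes e: "e \<in> J" "proj e" "e \<noteq> 0"
  shows "\<exists>g\<in>J. proj g \<and> g \<noteq> 0 \<and> e o\<^sub>L g = g \<and> nn (\<tau> e - 2 ^ n *\<^sub>R \<tau> g)"
proof (induction n)
  case 0
  show ?case
    using e by (intro bexI[of _ e]) (auto simp: projD)
next
  case (Suc n)
  then obtain g where g: "g \<in> J" "proj g" "g \<noteq> 0" "e o\<^sub>L g = g" "nn (\<tau> e - 2 ^ n *\<^sub>R \<tau> g)"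
    by blast
  obtain k where k: "k \<in> J" "proj k" "k \<noteq> 0" "g o\<^sub>L k = k" "nn (\<tau> g - 2 *\<^sub>R \<tau> k)"
    using halving[OF g(1-3)] by blast
  have "nn (2 ^ n *\<^sub>R (\<tau> g - 2 *\<^sub>R \<tau> k))"
    using k by (intro nn_scaleR) auto
  then have "nn (2 ^ n *\<^sub>R \<tau> g - 2 ^ Suc n *\<^sub>R \<tau> k)"
    by (simp add: scaleR_diff_right mult.commute)
  then have "nn (\<tau> e - 2 ^ Suc n *\<^sub>R \<tau> k)"
    using g(5) nn_diff_trans by blast
  moreover have "e o\<^sub>L k = k"
    using g(4) k(4) comp_assoc by metis
  ultimately show ?case
    using k by blast
qed

text \<open>Enough halvings push the trace below \<open>\<epsilon>\<close> times the identity.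
  Compression by \<open>z\<close> replaces the identity by \<open>z\<close> and fixes the trace of
  \<open>r\<close>, since z r = r.\<close>

lemma small_projection:
  assumes e: "e \<in> J" "proj e" "e \<noteq> 0" and z: "z \<in> Z" "proj z" "z o\<^sub>L e = e" and "\<epsilon> > 0"
  shows "\<exists>r\<in>J. proj r \<and> r \<noteq> 0 \<and> e o\<^sub>L r = r \<and> nn (\<epsilon> *\<^sub>R z - \<tau> r)"
proof -
  obtain n where "norm (\<tau> e) / \<epsilon> < 2 ^ n"
    using real_arch_pow[of 2 "norm (\<tau> e) / \<epsilon>"] by auto
  then have n: "norm (\<tau> e) < \<epsilon> * 2 ^ n"
    using \<open>\<epsilon> > 0\<close> by (simp add: field_simps)
  obtain r where r: "r \<in> J" "proj r" "r \<noteq> 0" "e o\<^sub>L r = r" "nn (\<tau> e - 2 ^ n *\<^sub>R \<tau> r)"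
    using iterated_halving[OF e] by blast
  have "z o\<^sub>L r = r"
    using z(3) r(4) comp_assoc by metis
  then have z\<tau>: "z o\<^sub>L \<tau> r = \<tau> r"
    using trace_Z_comp[OF z(1) r(1) proj_nn[OF r(2)]] by simp
  have \<tau>z: "\<tau> r o\<^sub>L z = \<tau> r"
    using Z_comm[OF z(1) Z_J[OF trace_Z[OF r(1) proj_nn[OF r(2)]]]] z\<tau> by simp
  have "nn ((\<epsilon> * 2 ^ n) *\<^sub>R id_blinfun - \<tau> e)"
    using n e by (intro nn_norm_diff nn_imp_sa trace_nn proj_nn) auto
  then have "nn ((\<epsilon> * 2 ^ n) *\<^sub>R id_blinfun - 2 ^ n *\<^sub>R \<tau> r)"
    using r(5) nn_diff_trans by blast
  then have "nn ((1 / 2 ^ n) *\<^sub>R ((\<epsilon> * 2 ^ n) *\<^sub>R id_blinfun - 2 ^ n *\<^sub>R \<tau> r))"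
    by (intro nn_scaleR) auto
  then have "nn (\<epsilon> *\<^sub>R id_blinfun - \<tau> r)"
    by (simp add: scaleR_diff_right)
  from nn_sandwich[OF this projD(1)[OF z(2)]] have "nn (\<epsilon> *\<^sub>R z - \<tau> r)"
    by (simp add: comp_simps comp_id z\<tau> \<tau>z projD[OF z(2)])
  then show ?thesis
    using r by blast
qed

text \<open>\<open>z\<close> is the spectral projection of \<open>v\<close> above
  \<open>\<epsilon>\<close>, half the norm of \<open>v\<close>. If it vanished, \<open>v\<close>
  would be at most \<open>\<epsilon>\<close>, which is less than its norm. The support projection
  \<open>u\<close> of \<open>v\<close> stands in for the identity, which may lie outside
  \<open>Z\<close>.\<close>

lemma central_lower_bound:
  assumes v: "v \<in> Z" "nn v" "v \<noteq> 0"
  obtains z \<epsilon> where "z \<in> Z" "proj z" "z \<noteq> 0" "\<epsilon> > 0" "nn ((z o\<^sub>L v) - \<epsilon> *\<^sub>R z)"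
proof -
  define \<delta> where "\<delta> = 1 / (norm v)"
  have \<delta>: "\<delta> > 0"
    using v(3) by (simp add: \<delta>_def)
  have "nn (id_blinfun - \<delta> *\<^sub>R v)"
    using nn_norm_diff[of "\<delta> *\<^sub>R v" 1] v by (simp add: \<delta>_def sa_scaleR nn_imp_sa)
  then obtain u where u: "u \<in> Z" "proj u" "\<delta> *\<^sub>R v o\<^sub>L u = \<delta> *\<^sub>R v"
    using range_projection[OF Z_sj strong_jordanD(3)[OF Z_sj v(1)] nn_scaleR[OF v(2)], of \<delta>] \<delta>
    by (metis less_imp_le)
  have vu: "v o\<^sub>L u = v"
    using u(3) \<delta> by (simp add: comp_simps)
  define \<epsilon> where "\<epsilon> = norm v / 2"
  have \<epsilon>: "\<epsilon> > 0"
    using v(3) by (simp add: \<epsilon>_def)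
  define y where "y = v - \<epsilon> *\<^sub>R u"
  have "y \<in> Z"
    unfolding y_def by (intro strong_jordan_diff[OF Z_sj] strong_jordanD(3)[OF Z_sj] u v)
  moreover have "sa y"
    unfolding y_def by (intro sa_diff sa_scaleR nn_imp_sa[OF v(2)] projD(1)[OF u(2)])
  ultimately obtain c where c: "c \<in> Z" "proj c" and cy: "nn (c o\<^sub>L y)" "nn ((c o\<^sub>L y) - y)"
    using positive_part_projection[OF Z_sj] by metis
  define z where "z = c o\<^sub>L u"
  have cu: "c o\<^sub>L u = u o\<^sub>L c" and uv: "u o\<^sub>L v = v"
    using Z_comm[OF c(1) Z_J[OF u(1)]] Z_comm[OF u(1) Z_J[OF v(1)]] vu by simp_all
  have zv: "z o\<^sub>L v = c o\<^sub>L v"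
    by (simp add: z_def comp_assoc uv)
  show ?thesis
  proof
    show "z \<in> Z"
      using c u by (simp add: z_def Z_comp_Z)
    show "proj z"
      unfolding z_def using c u cu by (intro proj_comp)
    show "nn ((z o\<^sub>L v) - \<epsilon> *\<^sub>R z)"
      unfolding zv using cy(1) by (simp add: y_def z_def comp_simps)
    show "z \<noteq> 0"
    proof
      assume "z = 0"
      then have "c o\<^sub>L y = 0"
        using zv by (simp add: y_def comp_simps flip: z_def)
      then have "nn (\<epsilon> *\<^sub>R u - v)"
        using cy(2) by (simp add: y_def)
      moreover have "nn (\<epsilon> *\<^sub>R (id_blinfun - u))"
        using \<epsilon> u by (intro nn_scaleR proj_nn proj_id_diff) auto
      ultimately have "nn (\<epsilon> *\<^sub>R id_blinfun - v)"
        using nn_add by (fastforce simp: scaleR_diff_right)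
      then have "nn ((1 / \<epsilon>) *\<^sub>R (\<epsilon> *\<^sub>R id_blinfun - v))"
        using \<epsilon> by (intro nn_scaleR) auto
      then have "norm ((1 / \<epsilon>) *\<^sub>R v) \<le> 1"
        using \<epsilon> v by (intro norm_le_of_nn_le_id nn_scaleR) (auto simp: scaleR_diff_right)
      then show False
        using v(3) by (simp add: \<epsilon>_def)
    qed
  qed (rule \<epsilon>)
qed

end

section \<open>Suprema of chains of projections\<close>

lemma strong_limit_eventually_0:
  assumes "F \<noteq> bot" "strong_limit F T S" "\<forall>\<^sub>F i in F. T i = 0"
  shows "S = 0"
proof (rule blinfun_eqI)
  fix h
  have "((\<lambda>i. T i h) \<longlongrightarrow> S h) F"
    using assms(2) by (simp add: strong_limit_def)
  moreover have "\<forall>\<^sub>F i in F. T i h = 0"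
    using assms(3) by eventually_elim simp
  then have "((\<lambda>i. T i h) \<longlongrightarrow> 0) F"
    by (rule tendsto_eventually)
  ultimately show "S h = blinfun_apply 0 h"
    using assms(1) tendsto_unique by fastforce
qed

text \<open>A chain is a net indexed by itself.\<close>

definition tails :: "('h::complex_hilbert \<Rightarrow>\<^sub>L 'h) set \<Rightarrow> ('h \<Rightarrow>\<^sub>L 'h) filter" where
  "tails C = (INF a\<in>C. principal {b \<in> C. nn (b - a)})"

lemma eventually_tails:
  assumes "C \<noteq> {}" and chain: "\<And>a b. a \<in> C \<Longrightarrow> b \<in> C \<Longrightarrow> nn (a - b) \<or> nn (b - a)"
  shows "eventually P (tails C) \<longleftrightarrow> (\<exists>a\<in>C. \<forall>b\<in>C. nn (b - a) \<longrightarrow> P b)"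
proof -
  have "\<exists>x\<in>C. principal {b \<in> C. nn (b - x)} \<le>
      inf (principal {d \<in> C. nn (d - a)}) (principal {d \<in> C. nn (d - b)})"
    if "a \<in> C" "b \<in> C" for a b
    using chain[OF that]
  proof
    assume "nn (a - b)"
    then show ?thesis
      using that by (intro bexI[of _ a]) (auto intro: nn_diff_trans)
  next
    assume "nn (b - a)"
    then show ?thesis
      using that by (intro bexI[of _ b]) (auto intro: nn_diff_trans)
  qed
  then show ?thesis
    unfolding tails_def using assms(1) by (subst eventually_INF_base) (auto simp: eventually_principal)
qed

text \<open>For each \<open>h\<close> the numbers \<open>rin h (a h)\<close> increase along the
  chain to their supremum. Idempotence and inequalities pass to the strong limit, so
  \<open>S\<close> is the least upper bound of \<open>C\<close>, even among operators outside the
  algebra.\<close>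

lemma chain_strong_limit:
  fixes C :: "('h::complex_hilbert \<Rightarrow>\<^sub>L 'h) set"
  assumes "C \<noteq> {}" and chain: "\<And>a b. a \<in> C \<Longrightarrow> b \<in> C \<Longrightarrow> nn (a - b) \<or> nn (b - a)"
    and C: "\<And>a. a \<in> C \<Longrightarrow> proj a"
  obtains S where "strong_limit (tails C) (\<lambda>a. a) S" "tails C \<noteq> bot" "\<forall>\<^sub>F a in tails C. a \<in> C"
    "proj S" "\<And>a. a \<in> C \<Longrightarrow> nn (S - a)" "\<And>u. (\<And>a. a \<in> C \<Longrightarrow> nn (u - a)) \<Longrightarrow> nn (u - S)"
proof -
  have ev: "eventually P (tails C) \<longleftrightarrow> (\<exists>a\<in>C. \<forall>b\<in>C. nn (b - a) \<longrightarrow> P b)" for P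
    by (rule eventually_tails[OF assms(1)]) (rule chain)
  have nonbot: "tails C \<noteq> bot"
  proof
    assume "tails C = bot"
    then have "\<forall>\<^sub>F a in tails C. False"
      by simp
    then obtain a where "a \<in> C" "\<forall>b\<in>C. \<not> nn (b - a)"
      using ev[of "\<lambda>_. False"] by blast
    then show False
      by (metis diff_self nn_zero)
  qed
  have inC: "\<forall>\<^sub>F a in tails C. a \<in> C"
    unfolding ev using assms(1) by blast
  have above: "\<forall>\<^sub>F b in tails C. nn (b - a)" if "a \<in> C" for a
    unfolding ev using that by blast
  have "\<exists>S. strong_limit (tails C) (\<lambda>a. a) S"
  proof (rule monotone_strong_limit_exists[OF nonbot inC])
    fix h :: 'h
    let ?f = "\<lambda>a :: 'h \<Rightarrow>\<^sub>L 'h. rin h (a h)"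
    have bdd: "bdd_above (?f ` C)"
    proof (rule bdd_aboveI2)
      show "?f a \<le> rin h h" if "a \<in> C" for a
        using nnD[OF proj_nn[OF proj_id_diff[OF C[OF that]]], of h] by (simp add: op_simps rin_simps)
    qed
    have "(?f \<longlongrightarrow> (SUP a\<in>C. ?f a)) (tails C)"
    proof (rule order_tendstoI)
      fix x assume "x < (SUP a\<in>C. ?f a)"
      then obtain a where a: "a \<in> C" "x < ?f a"
        using less_cSUP_iff[OF assms(1) bdd] by blast
      show "\<forall>\<^sub>F a in tails C. x < ?f a"
        using above[OF a(1)]
      proof eventually_elim
        case (elim b)
        then show ?case
          using a(2) nnD[OF elim, of h] by (simp add: op_simps rin_simps)
      qed
    next
      fix x assume x: "(SUP a\<in>C. ?f a) < x"
      show "\<forall>\<^sub>F a in tails C. ?f a < x"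
        using inC
      proof eventually_elim
        case (elim a)
        show ?case
          using cSUP_upper[OF elim bdd] x by (rule le_less_trans)
      qed
    qed
    then show "\<exists>l. (?f \<longlongrightarrow> l) (tails C)" ..
  qed (use C chain in \<open>auto intro: proj_nn proj_id_diff\<close>)
  then obtain S where S: "strong_limit (tails C) (\<lambda>a. a) S" ..
  have "strong_limit (tails C) (\<lambda>a. (a o\<^sub>L a) - a) ((S o\<^sub>L S) - S)"
    by (intro strong_limit_diff strong_limit_comp S)
  moreover have "\<forall>\<^sub>F a in tails C. (a o\<^sub>L a) - a = 0"
    using inC by eventually_elim (simp add: C projD)
  ultimately have "(S o\<^sub>L S) - S = 0"
    by (rule strong_limit_eventually_0[OF nonbot])
  moreover have "\<forall>\<^sub>F a in tails C. sa a"
    using inC by eventually_elim (simp add: C projD)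
  then have "sa S"
    by (rule strong_limit_sa[OF nonbot S])
  ultimately have projS: "proj S"
    by (simp add: proj_def)
  have upper: "nn (S - a)" if "a \<in> C" for a
    by (rule strong_limit_nn[OF nonbot strong_limit_diff[OF S strong_limit_const] above[OF that]])
  have least: "nn (u - S)" if u: "\<And>a. a \<in> C \<Longrightarrow> nn (u - a)" for u
  proof (rule strong_limit_nn[OF nonbot strong_limit_diff[OF strong_limit_const S]])
    show "\<forall>\<^sub>F a in tails C. nn (u - a)"
      using inC by eventually_elim (rule u)
  qed
  show ?thesis
    by (rule that[OF S nonbot inC projS upper least])
qed

theorem proposition5p1:
  fixes J :: "('h::complex_hilbert \<Rightarrow>\<^sub>L 'h) set"
    and \<tau> :: "('h \<Rightarrow>\<^sub>L 'h) \<Rightarrow> ('h \<Rightarrow>\<^sub>L 'h)"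
    and p w :: "'h \<Rightarrow>\<^sub>L 'h"
  assumes "jw_star_algebra J" and "type_II1 J"
    and "centre_valued_trace J \<tau>" and "faithful_trace J \<tau>" and "normal_trace J \<tau>"
    and "p \<in> projections J"
    and "w \<in> jcentre J" and "0 \<preceq> w" and "w \<preceq> \<tau> p"
  shows "\<exists>q\<in>projections J. q \<preceq> p \<and> \<tau> q = w"
proof -
  interpret traced_jw_algebra J \<tau>
    using assms(1,2,3) by unfold_locales (auto simp: type_II1_def type_II_def)
  have projs: "q \<in> projections J \<longleftrightarrow> q \<in> J \<and> proj q" for q
    by (rule projections_iff[OF jw_star_algebraD(1)[OF jw]])
  have J0: "0 \<in> J"
    by (rule strong_jordanD(1)[OF sj])
  have p: "p \<in> J" "proj p"
    using assms(6) by (auto simp: projs)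
  have wJ: "w \<in> J"
    using assms(7) by (simp add: jcentre_def)
  have w: "nn w"
    using assms(8) op_le_iff_nn[OF jw J0 wJ] by simp
  have wZ: "w \<in> Z"
    by (rule jcentre_sa_commutant_centre[OF jw assms(7) nn_imp_sa[OF w]])
  have wp: "nn (\<tau> p - w)"
    using assms(9) op_le_iff_nn[OF jw wJ Z_J[OF trace_Z[OF p(1) proj_nn[OF p(2)]]]] by simp
  define A where "A = {q \<in> J. proj q \<and> p o\<^sub>L q = q \<and> nn (w - \<tau> q)}"
  let ?P = "\<lambda>a b. nn (b - a)"
  have "\<exists>q\<in>A. \<forall>a\<in>A. nn (a - q) \<longrightarrow> a = q"
  proof (rule predicate_Zorn)
    show "partial_order_on A (relation_of ?P A)"
      unfolding partial_order_on_def preorder_on_def refl_on_def trans_on_def antisym_on_def relation_of_def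
      by (auto intro: nn_diff_trans nn_antisym)
    fix C assume "C \<in> Chains (relation_of ?P A)"
    then have CA: "C \<subseteq> A" and chain: "\<And>a b. a \<in> C \<Longrightarrow> b \<in> C \<Longrightarrow> nn (a - b) \<or> nn (b - a)"
      by (auto simp: Chains_def relation_of_def)
    show "\<exists>u\<in>A. \<forall>a\<in>C. nn (u - a)"
    proof (cases "C = {}")
      case True
      have "\<tau> 0 = 0"
        using trace_add[OF J0 J0] by simp
      then have "0 \<in> A"
        using J0 w by (simp add: A_def proj_def)
      then show ?thesis
        using True by blast
    next
      case False
      have C: "a \<in> J" "proj a" "p o\<^sub>L a = a" "nn (w - \<tau> a)" "\<tau> a \<in> Z" if "a \<in> C" for a
        using CA that trace_Z proj_nn by (auto simp: A_def)
      obtain S where S: "strong_limit (tails C) (\<lambda>a. a) S" "tails C \<noteq> bot" "\<forall>\<^sub>F a in tails C. a \<in> C"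
        and proj_S: "proj S" and upper: "\<And>a. a \<in> C \<Longrightarrow> nn (S - a)"
        and least: "\<And>u. (\<And>a. a \<in> C \<Longrightarrow> nn (u - a)) \<Longrightarrow> nn (u - S)"
        using chain_strong_limit[OF False chain C(2)] by metis
      have "\<forall>\<^sub>F a in tails C. a \<in> J"
        using S(3) by eventually_elim (rule C(1))
      then have SJ: "S \<in> J"
        by (rule jw_star_algebra_strong_limit[OF jw S(2,1)])
      have "nn (p - S)"
        using p C by (intro least) (simp add: proj_le_iff)
      then have pS: "p o\<^sub>L S = S"
        using p proj_S by (simp add: proj_le_iff)
      have "least (op_order J) S (Upper (op_order J) C)"
      proof -
        have "nn (u - S)" if "u \<in> J" "\<And>a. a \<in> C \<Longrightarrow> a \<preceq> u" for u
          using that C(1) by (intro least) (simp add: op_le_iff_nn[OF jw])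
        then show ?thesis
          using C(1) SJ upper by (auto simp: least_def Upper_def op_order_def op_le_iff_nn[OF jw])
      qed
      moreover have "C \<subseteq> {a \<in> J. 0 \<preceq> a}"
        using C J0 by (auto simp: op_le_iff_nn[OF jw] proj_nn)
      moreover have "\<exists>c\<in>C. a \<preceq> c \<and> b \<preceq> c" if "a \<in> C" "b \<in> C" for a b
      proof (cases "nn (a - b)")
        case True
        then show ?thesis
          using that C(1) by (intro bexI[of _ a]) (auto simp: op_le_iff_nn[OF jw])
      next
        case False
        then show ?thesis
          using that C(1) chain[OF that] by (intro bexI[of _ b]) (auto simp: op_le_iff_nn[OF jw])
      qed
      ultimately have "least (op_order (jcentre J)) (\<tau> S) (Upper (op_order (jcentre J)) (\<tau> ` C))"
        using assms(5) False unfolding normal_trace_def by blast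
      \<comment> \<open>The supremum of the traces is formed in the centre, and \<open>w\<close>
        lies there, so it is one of the upper bounds with which \<tau> S is compared.\<close>
      moreover have "w \<in> Upper (op_order (jcentre J)) (\<tau> ` C)"
        using assms(7) C wJ by (auto simp: Upper_def op_order_def op_le_iff_nn[OF jw] Z_J)
      ultimately have "\<tau> S \<preceq> w"
        by (simp add: least_def op_order_def)
      then have "nn (w - \<tau> S)"
        using op_le_iff_nn[OF jw Z_J[OF trace_Z[OF SJ proj_nn[OF proj_S]]] wJ] by simp
      then have "S \<in> A"
        using SJ proj_S pS by (simp add: A_def)
      then show ?thesis
        using upper by blast
    qed
  qed
  then obtain q where q: "q \<in> J" "proj q" "p o\<^sub>L q = q" "nn (w - \<tau> q)"
    and maximal: "\<And>a. a \<in> A \<Longrightarrow> nn (a - q) \<Longrightarrow> a = q"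
    by (auto simp: A_def)
  have "w - \<tau> q = 0"
  proof (rule ccontr)
    assume nz: "w - \<tau> q \<noteq> 0"
    define v where "v = w - \<tau> q"
    have vZ: "v \<in> Z"
      unfolding v_def using q wZ by (intro strong_jordan_diff[OF Z_sj] trace_Z proj_nn)
    obtain z \<epsilon> where z: "z \<in> Z" "proj z" "z \<noteq> 0" and \<epsilon>: "\<epsilon> > 0" "nn ((z o\<^sub>L v) - \<epsilon> *\<^sub>R z)"
      using central_lower_bound[OF vZ] q(4) nz unfolding v_def by blast
    define d where "d = p - q"
    have d: "d \<in> J" "proj d"
      unfolding d_def using p q by (auto intro: strong_jordan_diff[OF sj] proj_diff)
    have dq: "d o\<^sub>L q = 0" "q o\<^sub>L d = 0" and pd: "p o\<^sub>L d = d"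
      using p q proj_diff(1)[OF q(2) p(2) q(3)] by (simp_all add: d_def comp_simps projD)
    have zv: "z o\<^sub>L v = v o\<^sub>L z"
      by (rule Z_comm[OF z(1) Z_J[OF vZ]])
    define e where "e = z o\<^sub>L d"
    have zd: "z o\<^sub>L d = d o\<^sub>L z"
      by (rule Z_comm[OF z(1) d(1)])
    have e: "e \<in> J" "proj e"
      unfolding e_def by (rule Z_comp_J[OF z(1) d(1)], rule proj_comp[OF z(2) d(2) zd])
    have ze: "z o\<^sub>L e = e" and de: "d o\<^sub>L e = e"
      by (rule blinfun_eqI; simp add: e_def proj_apply z d flip: comp_commD[OF zd])+
    \<comment> \<open>Since \<tau> d - v = \<tau> p - w \<ge> 0, the case e = 0 would give z v \<le>
      z \<tau> d = 0. This contradicts z v \<ge> \<epsilon> z, as \<open>z\<close> is not 0.\<close>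
    have "e \<noteq> 0"
    proof
      assume "e = 0"
      have "z o\<^sub>L \<tau> d = \<tau> e"
        using trace_Z_comp[OF z(1) d(1) proj_nn[OF d(2)]] by (simp add: e_def)
      also have "\<dots> = 0"
        using trace_add[OF J0 J0] \<open>e = 0\<close> by simp
      finally have z\<tau>: "z o\<^sub>L \<tau> d = 0" .
      have "\<tau> d - v = \<tau> p - w"
        using trace_diff[OF p(1) q(1)] by (simp add: d_def v_def)
      then have "nn (z o\<^sub>L (\<tau> d - v) o\<^sub>L z)"
        using wp z by (intro nn_sandwich) (auto simp: projD)
      moreover have "z o\<^sub>L (\<tau> d - v) o\<^sub>L z = - (z o\<^sub>L v)"
        by (simp add: comp_simps z\<tau> comp_assoc flip: zv) (simp add: projD(2)[OF z(2)] flip: comp_assoc)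
      ultimately have "nn (0 - (z o\<^sub>L v))"
        by simp
      from nn_add[OF this \<epsilon>(2)] have "nn (- (\<epsilon> *\<^sub>R z))"
        by simp
      moreover have "nn (\<epsilon> *\<^sub>R z)"
        using \<epsilon> z by (intro nn_scaleR proj_nn) auto
      ultimately have "\<epsilon> *\<^sub>R z = 0"
        by (intro nn_antisym) auto
      then show False
        using z \<epsilon> by simp
    qed
    then obtain r where r: "r \<in> J" "proj r" "r \<noteq> 0" "e o\<^sub>L r = r" "nn (\<epsilon> *\<^sub>R z - \<tau> r)"
      using small_projection[OF e _ z(1,2) ze \<epsilon>(1)] by blast
    have "nn v"
      using q(4) by (simp add: v_def)
    \<comment> \<open>This gives z v \<le> v and completes the chain \<tau> r \<le> \<epsilon> z
      \<le> z v \<le> v, so \<open>r\<close> can be added to \<open>q\<close> without exceeding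
      \<open>w\<close>.\<close>
    have "nn ((id_blinfun - z) o\<^sub>L v o\<^sub>L (id_blinfun - z))"
      using \<open>nn v\<close> z by (intro nn_sandwich projD(1) proj_id_diff)
    moreover have "(id_blinfun - z) o\<^sub>L v o\<^sub>L (id_blinfun - z) = v - (z o\<^sub>L v)"
      by (rule blinfun_eqI) (simp add: op_simps proj_apply[OF z(2)] flip: comp_commD[OF zv])
    ultimately have "nn (v - (z o\<^sub>L v))"
      by simp
    then have "nn (v - \<tau> r)"
      using \<epsilon>(2) r(5) nn_diff_trans by metis
    then have "nn (w - \<tau> (q + r))"
      using trace_add[OF q(1) r(1)] by (simp add: v_def algebra_simps)
    moreover have dr: "d o\<^sub>L r = r"
      using de r(4) comp_assoc by metis
    have "q o\<^sub>L r = 0" "p o\<^sub>L r = r"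
      using dr dq(2) pd comp_assoc[of q d r] comp_assoc[of p d r] by simp_all
    moreover have "r o\<^sub>L q = 0"
      using proj_diff(1)[OF r(2) d(2) dr] dq(1) comp_assoc[of r d q] by simp
    ultimately have "q + r \<in> A"
      using q r by (simp add: A_def strong_jordanD(2)[OF sj] proj_add comp_simps)
    then have "q + r = q"
      using proj_nn[OF r(2)] by (intro maximal) simp_all
    then show False
      using r(3) by simp
  qed
  moreover have "q \<preceq> p"
    using p q by (simp add: op_le_iff_nn[OF jw] proj_le_iff)
  ultimately show ?thesis
    using q by (auto simp: projs)
qed

end
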